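(* Let $m \geq 0$ and $n > 0$ be integers, let $P(m,n)$ denote the paradromic ring obtained from a strip with $m$ half twists cut into $n$ sections, and let $T(u,v)$ denote the $(u,v)$ torus link. Equality below means equivalence of links in $\mathbb{R}^3$. If $n = 1$, then $P(m,1) = T(0,1)$. If $n > 1$, then $$ P(m,n) = \begin{cases} T\left(\tfrac12 mn,\, n\right) & \text{if } mn \text{ is even,} \\[4pt] T\left(\tfrac12 m(n-1),\, n-1\right) \cup C & \text{if } mn \text{ is odd,} \end{cases} $$ where $T(u,v)\cup C$ denotes the torus link $T(u,v)$ lying on a standard torus together with one additional component $C$, the core of that torus.
   Context: A link is a finite collection of disjoint simple closed curves (components) embedded in $\mathbb{R}^3$; a knot is a link with one component. Two links are equivalent (considered equal) if one can be moved to the other in space without passing the curves through themselves or each other (ambient isotopy). Paradromic ring $P(m,n)$ ($m\ge 0$, $n\ge 1$ integers): take a rectangular strip, draw lines parallel to its long sides dividing it into $n$ strips of equal width, join the two short ends after putting in $m$ half twists (all in the same direction) so as to form an otherwise unknotted band, and cut along the lines (which match up to closed curves in the band). Replace each resulting loop of paper, whose width is $1/n$ of that of the original strip, by the closed curve running along its midline. The resulting link is $P(m,n)$. Here the original band may be taken as follows: its centerline is the core circle of a standard torus, the band lies inside the solid torus, all $m$ half twists are collected in a cylindrical portion of the solid torus, and outside this portion the band is flat, lying in the $xy$-plane between the inner and outer equators. Standard torus: the surface in $\mathbb{R}^3$ obtained by rotating about the $z$-axis a circle of radius $b$ whose center lies in the $xy$-plane at distance $a>b$ from the $z$-axis. Its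 core $C$ is the circle of radius $a$ in the $xy$-plane centered at the origin. The inner and outer equators are the circles of radius $a-b$ and $a+b$ in which the $xy$-plane meets the torus. A longitude is a closed curve on the torus parallel to the equators and looping once around the $z$-axis. A meridian is a simple closed curve on the torus that intersects each longitude once and bounds a disk inside the torus. Torus link $T(u,v)$ ($u \ge 0$, $v\ge 1$ integers): the link of $\gcd(u,v)$ components (with $\gcd(0,v)=v$) that can be arranged on the standard torus, without self-crossings, so that it intersects each longitude $u$ times and each meridian $v$ times; that is, it consists of $d=\gcd(u,v)$ parallel simple closed curves on the torus, each winding $v/d$ times in the longitudinal direction and $u/d$ times in the meridional direction. The handedness of $T(u,v)$ is taken to agree with the direction of the half twists in $P(m,n)$. *)

theory Defs
  imports "HOL-Analysis.Analysis"
begin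

section \<open>Links and their equivalence\<close>

text \<open>A link is represented by the subset of space it occupies; its components are the connected
  components of that set.\<close>

definition simple_closed_curve :: "(real^3) set \<Rightarrow> bool" where
  "simple_closed_curve K \<longleftrightarrow>
     (\<exists>\<gamma>. simple_path \<gamma> \<and> pathfinish \<gamma> = pathstart \<gamma> \<and> path_image \<gamma> = K)"

definition is_link :: "(real^3) set \<Rightarrow> bool" where
  "is_link L \<longleftrightarrow>
     (\<exists>\<K>. finite \<K> \<and> pairwise disjnt \<K> \<and> (\<forall>K\<in>\<K>. simple_closed_curve K) \<and> \<Union>\<K> = L)"

text \<open>An ambient isotopy is a homotopy, starting at the identity, through self-homeomorphisms
  of the whole space.\<close>

definition ambient_isotopic :: "(real^3) set \<Rightarrow> (real^3) set \<Rightarrow> bool" where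
  "ambient_isotopic L L' \<longleftrightarrow>
     (\<exists>f. homotopic_with_canon (\<lambda>h. \<exists>g. homeomorphism UNIV UNIV h g) UNIV UNIV id f \<and> f ` L = L')"

definition link_equiv :: "(real^3) set \<Rightarrow> (real^3) set \<Rightarrow> bool"  (infix "\<simeq>\<^sub>L" 50) where
  "L \<simeq>\<^sub>L L' \<longleftrightarrow> is_link L \<and> is_link L' \<and> ambient_isotopic L L'"

section \<open>The standard torus and torus links\<close>

text \<open>The half-plane through the \<open>z\<close>-axis at angle \<open>\<theta>\<close> meets the core (the circle of radius \<open>a\<close>) in
  one point. In polar coordinates of that half-plane centred there, \<open>tube_point a \<theta> r \<phi>\<close> has radius
  \<open>r\<close> and angle \<open>\<phi>\<close>, with \<open>\<phi> = 0\<close> pointing away from the \<open>z\<close>-axis. The standard torus is \<open>r = b\<close>, and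
  the outer and inner equators are \<open>r = b\<close>, \<open>\<phi> = 0\<close> and \<open>r = b\<close>, \<open>\<phi> = pi\<close>. Negative \<open>r\<close> is used below
  for points on the opposite side of the core.\<close>

definition tube_point :: "real \<Rightarrow> real \<Rightarrow> real \<Rightarrow> real \<Rightarrow> real^3" where
  "tube_point a \<theta> r \<phi> =
     vector [(a + r * cos \<phi>) * cos \<theta>, (a + r * cos \<phi>) * sin \<theta>, r * sin \<phi>]"

definition torus_core :: "real \<Rightarrow> (real^3) set" where
  "torus_core a = (\<lambda>\<theta>. tube_point a \<theta> 0 0) ` {0..2 * pi}"

text \<open>With \<open>d = gcd u v\<close>, the torus link consists of \<open>d\<close> parallel curves, the \<open>k\<close>-th one winding
  \<open>v div d\<close> times longitudinally and \<open>u div d\<close> times meridionally at constant speed. Together they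
  form the set of points of the torus with \<open>v * \<phi> - u * \<theta> \<in> 2 * pi * \<int>\<close>, which meets every meridian
  (constant \<open>\<theta>\<close>) in \<open>v\<close> equally spaced points and, if \<open>u > 0\<close>, every longitude (constant \<open>\<phi>\<close>) in
  \<open>u\<close> points. It is intended for \<open>v > 0\<close> only.\<close>

definition torus_link_component :: "real \<Rightarrow> real \<Rightarrow> nat \<Rightarrow> nat \<Rightarrow> nat \<Rightarrow> real \<Rightarrow> real^3" where
  "torus_link_component a b u v k t =
     tube_point a (2 * pi * real (v div gcd u v) * t) b
       (2 * pi * real (u div gcd u v) * t + 2 * pi * real k / real v)"

definition torus_link :: "real \<Rightarrow> real \<Rightarrow> nat \<Rightarrow> nat \<Rightarrow> (real^3) set" where
  "torus_link a b u v = (\<Union>k<gcd u v. path_image (torus_link_component a b u v k))"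

section \<open>Paradromic rings\<close>

text \<open>The strip is \<open>{0..2 * pi} \<times> {-b..b}\<close>. The point \<open>(\<theta>, s)\<close> is placed in the half-plane at angle
  \<open>\<theta>\<close>, at signed distance \<open>s\<close> from the core along a line that turns by \<open>m * pi\<close> as \<open>\<theta>\<close> runs through
  \<open>{\<alpha>..\<beta>}\<close> and lies in the \<open>xy\<close>-plane for all other \<open>\<theta>\<close>. The short ends are thereby glued by
  \<open>(2 * pi, s) \<sim> (0, (-1)^m * s)\<close>. Both this turning and the torus links use increasing \<open>\<phi>\<close> for
  increasing \<open>\<theta>\<close>, so the handedness agrees.\<close>

definition twist_angle :: "real \<Rightarrow> real \<Rightarrow> nat \<Rightarrow> real \<Rightarrow> real" where
  "twist_angle \<alpha> \<beta> m \<theta> = real m * pi * max 0 (min 1 ((\<theta> - \<alpha>) / (\<beta> - \<alpha>)))"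

definition twisted_band :: "real \<Rightarrow> real \<Rightarrow> real \<Rightarrow> nat \<Rightarrow> real \<times> real \<Rightarrow> real^3" where
  "twisted_band a \<alpha> \<beta> m = (\<lambda>(\<theta>, s). tube_point a \<theta> s (twist_angle \<alpha> \<beta> m \<theta>))"

text \<open>Height of the midline of the \<open>k\<close>-th of the \<open>n\<close> strips of width \<open>2 * b / n\<close>.\<close>

definition midline :: "real \<Rightarrow> nat \<Rightarrow> nat \<Rightarrow> real" where
  "midline b n k = - b + (real k + 1 / 2) * (2 * b / real n)"

definition paradromic_ring :: "real \<Rightarrow> real \<Rightarrow> real \<Rightarrow> real \<Rightarrow> nat \<Rightarrow> nat \<Rightarrow> (real^3) set" where
  "paradromic_ring a b \<alpha> \<beta> m n = twisted_band a \<alpha> \<beta> m ` ({0..2 * pi} \<times> midline b n ` {..<n})"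

end

theory Submission imports Defs begin

text \<open>Cut the solid torus into meridian disks, one for each direction \<open>e\<close> (a unit complex number) around the
\<open>z\<close>-axis, with a complex coordinate \<open>w\<close> in each disk that vanishes at the core. Both links meet every
disk in finitely many points, so it suffices to move points inside the disks, continuously in \<open>e\<close>
and without touching a neighbourhood of the boundary. Such a motion is an ambient isotopy
(\<open>fibre_isotopy_link_equiv\<close>); only its continuity and its injectivity on each disk need checking,
because invariance of domain supplies the inverse homeomorphisms.

In the disk at angle \<open>\<theta>\<close> the ring consists of the midline points, lying on a line through the core
turned by \<open>twist_angle\<close>. That angle and \<open>m * \<theta> / 2\<close> agree at both ends of \<open>{0..2 * pi}\<close>, so rotating
the disks makes the twist uniform (\<open>spread_twist_evenly\<close>). The points then satisfy
\<open>w ^ q = z ^ q * e ^ M\<close>, with \<open>z\<close> ranging over a fixed finite set; here \<open>q = 2\<close>, \<open>M = m\<close> always works,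
since midlines come in pairs \<open>\<plusminus>s\<close>, and \<open>q = 1\<close>, \<open>M = m / 2\<close> works when \<open>m\<close> is even. The torus link is
given by \<open>\<bar>w\<bar> = b\<close> and \<open>w ^ v = b ^ v * e ^ u\<close> (\<open>torus_link_eq_fibration\<close>).

If the numbers \<open>z\<close> are nonzero and have different moduli, two further motions lead from the first
equation to the second (\<open>spread_over_torus\<close>): a rotation by an angle depending on \<open>\<bar>w\<bar>\<close> spreads the
points equally over all directions, and then a radial stretch, whose factor depends on the direction,
brings all of them to radius \<open>b\<close>. For \<open>k\<close> numbers \<open>z\<close> the result is \<open>T(M * k, q * k)\<close>. Both motions
fix the core.

For \<open>m\<close> even, \<open>q = 1\<close> applies once the points have been shifted a little so that none lies on the
core and no two have the same modulus (\<open>shift_off_core\<close>): here \<open>k = n\<close>. For \<open>m\<close> odd the two points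
\<open>\<plusminus>s\<close> lie on one curve and have to move together, so \<open>q = 2\<close>, and \<open>k\<close> is the number of positive
midlines. If \<open>n\<close> is even, there are \<open>n / 2\<close> of them. If \<open>n\<close> is odd, there are \<open>(n - 1) / 2\<close>, and the
remaining midline, at height \<open>0\<close>, is the core.
A single strip gives the core whatever \<open>m\<close> is, so that case reduces to \<open>m = 0\<close>.\<close>

section \<open>Ambient isotopies and links\<close>

text \<open>The image is open by invariance of domain, and closed because it is a compact set together with the
complement of an open ball; hence it is everything.\<close>
lemma homeomorphism_of_injective_identity_at_infinity:
  fixes f :: "'a::euclidean_space \<Rightarrow> 'a"
  assumes cont: "continuous_on UNIV f" and inj: "inj f"
    and K: "bounded K" "\<And>x. x \<notin> K \<Longrightarrow> f x = x"
  shows "\<exists>g. homeomorphism UNIV UNIV f g"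
proof -
  obtain B where B: "K \<subseteq> ball 0 B"
    using bounded_subset_ballD[OF K(1)] by blast
  have "UNIV = cball 0 B \<union> - ball (0::'a) B"
    by auto
  then have "range f = f ` (cball 0 B \<union> - ball 0 B)"
    by (rule arg_cong)
  also have "\<dots> = f ` cball 0 B \<union> f ` (- ball 0 B)"
    by (rule image_Un)
  also have "f ` (- ball 0 B) = - ball 0 B"
    using B K(2) by (force simp: image_iff)
  finally have range_eq: "range f = f ` cball 0 B \<union> - ball 0 B" .
  have "closed (f ` cball 0 B)"
    by (intro compact_imp_closed compact_continuous_image continuous_on_subset[OF cont]) auto
  then have "closed (range f)"
    unfolding range_eq by (intro closed_Un closed_Compl open_ball)
  moreover have "open (range f)"
    using invariance_of_domain[OF cont open_UNIV inj] .
  ultimately have "range f = UNIV"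
    using clopen by blast
  then show ?thesis
    using invariance_of_domain_homeomorphism[OF open_UNIV cont order_refl inj] by metis
qed

lemma ambient_isotopicI:
  fixes h :: "real \<times> (real^3) \<Rightarrow> real^3"
  assumes cont: "continuous_on ({0..1} \<times> UNIV) h"
    and h0: "\<And>x. h (0, x) = x"
    and inj: "\<And>t. t \<in> {0..1} \<Longrightarrow> inj (\<lambda>x. h (t, x))"
    and K: "bounded K" "\<And>t x. x \<notin> K \<Longrightarrow> h (t, x) = x"
  shows "ambient_isotopic L ((\<lambda>x. h (1, x)) ` L)"
proof -
  have "\<exists>g. homeomorphism UNIV UNIV (\<lambda>x. h (t, x)) g" if t: "t \<in> {0..1}" for t
  proof (rule homeomorphism_of_injective_identity_at_infinity[OF _ inj[OF t] K])
    show "continuous_on UNIV (\<lambda>x. h (t, x))"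
      by (rule continuous_on_compose2[OF cont]) (use t in \<open>auto intro!: continuous_intros\<close>)
  qed
  moreover have "continuous_map (prod_topology (top_of_set {0..1}) euclidean) euclidean h"
    using cont by (simp add: prod_topology_subtopology)
  ultimately have "homotopic_with_canon (\<lambda>h. \<exists>g. homeomorphism UNIV UNIV h g) UNIV UNIV id (\<lambda>x. h (1, x))"
    unfolding homotopic_with_def using h0
    by (intro exI[of _ h]) auto
  then show ?thesis
    unfolding ambient_isotopic_def by blast
qed

lemma is_link_injective_image:
  assumes "continuous_on UNIV f" "inj f" "is_link L"
  shows "is_link (f ` L)"
proof -
  obtain \<K> where \<K>: "finite \<K>" "pairwise disjnt \<K>" "\<And>K. K \<in> \<K> \<Longrightarrow> simple_closed_curve K" "\<Union>\<K> = L"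
    using assms(3) unfolding is_link_def by blast
  have "simple_closed_curve (f ` K)" if K: "K \<in> \<K>" for K
  proof -
    obtain \<gamma> where \<gamma>: "simple_path \<gamma>" "pathfinish \<gamma> = pathstart \<gamma>" "path_image \<gamma> = K"
      using \<K>(3)[OF K] unfolding simple_closed_curve_def by blast
    have "simple_path (f \<circ> \<gamma>)"
      by (meson simple_path_continuous_image \<gamma>(1) assms continuous_on_subset inj_on_subset subset_UNIV)
    then show ?thesis
      unfolding simple_closed_curve_def using \<gamma>
      by (metis path_image_compose pathfinish_compose pathstart_compose)
  qed
  moreover have "pairwise disjnt ((`) f ` \<K>)"
    using \<K>(2) by (auto simp: pairwise_image pairwise_def disjnt_def image_Int[OF assms(2), symmetric])
  ultimately show ?thesis
    unfolding is_link_def using \<K>(1,4)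
    by (intro exI[of _ "(`) f ` \<K>"]) (auto simp: image_Union)
qed

text \<open>This makes it enough to verify that the torus links, which have explicit parametrizations, are links.\<close>
lemma ambient_isotopic_is_link:
  assumes "ambient_isotopic L L'" "is_link L'"
  shows "is_link L"
proof -
  obtain f where "homotopic_with_canon (\<lambda>h. \<exists>g. homeomorphism UNIV UNIV h g) UNIV UNIV id f"
      and f: "f ` L = L'"
    using assms(1) unfolding ambient_isotopic_def by blast
  then obtain g where g: "homeomorphism UNIV UNIV f g"
    by (blast dest: homotopic_with_imp_property)
  then have "g ` L' = L"
    unfolding f[symmetric] by (simp add: homeomorphism_def image_image)
  moreover have "inj g"
    using g by (metis UNIV_I homeomorphism_def injI)
  ultimately show ?thesis
    using is_link_injective_image[of g L'] g assms(2) by (simp add: homeomorphism_def)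
qed

lemma is_link_Un:
  assumes "is_link L" "is_link L'" "L \<inter> L' = {}"
  shows "is_link (L \<union> L')"
proof -
  obtain \<K> \<K>' where "finite \<K>" "pairwise disjnt \<K>" "\<forall>K \<in> \<K>. simple_closed_curve K" "\<Union>\<K> = L"
     "finite \<K>'" "pairwise disjnt \<K>'" "\<forall>K \<in> \<K>'. simple_closed_curve K" "\<Union>\<K>' = L'"
    using assms(1,2) unfolding is_link_def by metis
  moreover from this have "pairwise disjnt (\<K> \<union> \<K>')"
    using assms(3) unfolding pairwise_def disjnt_def by blast
  ultimately show ?thesis
    unfolding is_link_def by (intro exI[of _ "\<K> \<union> \<K>'"]) auto
qed

section \<open>Coordinates on the solid torus\<close>

text \<open>The direction around the \<open>z\<close>-axis is recorded by a unit complex number rather than an angle, so that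
continuity on the solid torus needs no periodicity conditions.\<close>
definition torus_point :: "real \<Rightarrow> complex \<times> complex \<Rightarrow> real^3" where
  "torus_point a = (\<lambda>(e, w). vector [(a + Re w) * Re e, (a + Re w) * Im e, Im w])"

definition axis_projection :: "real^3 \<Rightarrow> complex" where
  "axis_projection x = Complex (x $ 1) (x $ 2)"

definition cross_section :: "real \<Rightarrow> real^3 \<Rightarrow> complex" where
  "cross_section a x = Complex (cmod (axis_projection x) - a) (x $ 3)"

lemma tube_point_eq: "tube_point a \<theta> r \<phi> = torus_point a (cis \<theta>, of_real r * cis \<phi>)"
  by (simp add: tube_point_def torus_point_def)

lemma continuous_on_vector_3 [continuous_intros]:
  fixes f g h :: "'a::topological_space \<Rightarrow> real"
  assumes "continuous_on S f" "continuous_on S g" "continuous_on S h"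
  shows "continuous_on S (\<lambda>x. vector [f x, g x, h x] :: real^3)"
proof -
  have eq: "(vector [f x, g x, h x] :: real^3) = (\<chi> i. if i = 1 then f x else if i = 2 then g x else h x)" for x
    by (simp add: vec_eq_iff forall_3 vector_3)
  show ?thesis
    unfolding eq
  proof (intro continuous_on_vec_lambda)
    fix i :: 3
    show "continuous_on S (\<lambda>x. if i = 1 then f x else if i = 2 then g x else h x)"
      using assms by (cases "i = 1"; cases "i = 2") simp_all
  qed
qed

lemma continuous_on_torus_point [continuous_intros]:
  "continuous_on S f \<Longrightarrow> continuous_on S g \<Longrightarrow> continuous_on S (\<lambda>x. torus_point a (f x, g x))"
  unfolding torus_point_def by (auto intro!: continuous_intros)

lemma continuous_on_axis_projection [continuous_intros]:
  "continuous_on S f \<Longrightarrow> continuous_on S (\<lambda>x. axis_projection (f x))"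
  unfolding axis_projection_def Complex_eq by (auto intro!: continuous_intros)

lemma continuous_on_cross_section [continuous_intros]:
  "continuous_on S f \<Longrightarrow> continuous_on S (\<lambda>x. cross_section a (f x))"
  unfolding cross_section_def Complex_eq by (auto intro!: continuous_intros)

text \<open>This holds even on the \<open>z\<close>-axis, where \<open>sgn\<close> gives direction \<open>0\<close> but the distance from the axis is \<open>0\<close> too.\<close>
lemma torus_point_coordinates:
  "torus_point a (sgn (axis_projection x), cross_section a x) = x"
proof -
  let ?p = "axis_projection x"
  have "cmod ?p * Re (sgn ?p) = Re ?p" "cmod ?p * Im (sgn ?p) = Im ?p"
    by (simp_all add: Complex.sgn_eq)
  then show ?thesis
    by (simp add: torus_point_def cross_section_def vec_eq_iff forall_3 vector_3 axis_projection_def)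
qed

lemma coordinates_torus_point:
  assumes "cmod e = 1" "cmod w < a"
  shows "sgn (axis_projection (torus_point a (e, w))) = e"
    and "cross_section a (torus_point a (e, w)) = w"
proof -
  have pos: "a + Re w > 0"
    using assms(2) abs_Re_le_cmod[of w] by linarith
  have p: "axis_projection (torus_point a (e, w)) = of_real (a + Re w) * e"
    by (simp add: torus_point_def axis_projection_def complex_eq_iff)
  have c: "cmod (of_real (a + Re w) * e) = a + Re w"
    using pos assms(1) by (simp add: norm_mult del: of_real_add)
  show "cross_section a (torus_point a (e, w)) = w"
    unfolding cross_section_def p c by (simp add: torus_point_def complex_eq_iff)
  show "sgn (axis_projection (torus_point a (e, w))) = e"
    unfolding p sgn_div_norm c using pos by (simp add: scaleR_conv_of_real del: of_real_add)
qed

lemma torus_point_eq_iff: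
  assumes "cmod e = 1" "cmod w < a" "cmod e' = 1" "cmod w' < a"
  shows "torus_point a (e, w) = torus_point a (e', w') \<longleftrightarrow> e = e' \<and> w = w'"
  using coordinates_torus_point[OF assms(1,2)] coordinates_torus_point[OF assms(3,4)] by metis

lemma bounded_tube: "bounded {x. cmod (cross_section a x) \<le> c}"
proof (rule boundedI)
  fix x assume "x \<in> {x. cmod (cross_section a x) \<le> c}"
  then have x: "cmod (cross_section a x) \<le> c" by simp
  have "\<bar>cmod (axis_projection x) - a\<bar> \<le> c" and z: "\<bar>x $ 3\<bar> \<le> c"
    using x abs_Re_le_cmod[of "cross_section a x"] abs_Im_le_cmod[of "cross_section a x"]
    by (auto simp: cross_section_def)
  then have "cmod (axis_projection x) \<le> \<bar>a\<bar> + c"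
    by linarith
  moreover have "\<bar>x $ 1\<bar> \<le> cmod (axis_projection x)" "\<bar>x $ 2\<bar> \<le> cmod (axis_projection x)"
    using abs_Re_le_cmod[of "axis_projection x"] abs_Im_le_cmod[of "axis_projection x"]
    by (auto simp: axis_projection_def)
  ultimately have xy: "\<bar>x $ 1\<bar> \<le> \<bar>a\<bar> + c" "\<bar>x $ 2\<bar> \<le> \<bar>a\<bar> + c"
    by (blast intro: order_trans)+
  have "norm x \<le> \<bar>x $ 1\<bar> + \<bar>x $ 2\<bar> + \<bar>x $ 3\<bar>"
    using norm_le_l1_cart[of x] by (simp add: sum_3)
  also have "\<dots> \<le> (\<bar>a\<bar> + c) + (\<bar>a\<bar> + c) + c"
    by (intro add_mono xy z)
  finally show "norm x \<le> (\<bar>a\<bar> + c) + (\<bar>a\<bar> + c) + c" .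
qed

section \<open>Isotopies moving every meridian disk in itself\<close>

text \<open>The parameters of \<open>G\<close> are the time, the direction \<open>e\<close> of the disk and the point of the disk. The whole
plane serves as the disk, the part \<open>c \<le> cmod w\<close> staying fixed.\<close>
definition fibre_isotopy :: "real \<Rightarrow> (real \<Rightarrow> complex \<Rightarrow> complex \<Rightarrow> complex) \<Rightarrow> bool" where
  "fibre_isotopy c G \<longleftrightarrow>
     continuous_on ({0..1} \<times> sphere 0 1 \<times> UNIV) (\<lambda>(t, e, w). G t e w) \<and>
     (\<forall>t\<in>{0..1}. \<forall>e\<in>sphere 0 1. inj (G t e)) \<and>
     (\<forall>t e w. c \<le> cmod w \<longrightarrow> G t e w = w) \<and>
     (\<forall>e w. G 0 e w = w)"

definition fibre_map :: "(complex \<Rightarrow> complex \<Rightarrow> complex) \<Rightarrow> complex \<times> complex \<Rightarrow> complex \<times> complex" where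
  "fibre_map g = (\<lambda>(e, w). (e, g e w))"

text \<open>A point that left the disk would land on a fixed point, against injectivity.\<close>
lemma fibre_isotopy_bounded:
  assumes "fibre_isotopy c G" "t \<in> {0..1}" "cmod e = 1" "cmod w < c"
  shows "cmod (G t e w) < c"
proof (rule ccontr)
  assume "\<not> ?thesis"
  then have "G t e (G t e w) = G t e w"
    using assms(1) unfolding fibre_isotopy_def by auto
  moreover have "inj (G t e)"
    using assms unfolding fibre_isotopy_def by auto
  ultimately have "G t e w = w" by (simp add: inj_eq)
  with \<open>\<not> ?thesis\<close> assms(4) show False by simp
qed

lemma fibre_isotopy_compose:
  assumes G: "fibre_isotopy c G" and H: "fibre_isotopy c H"
  shows "fibre_isotopy c (\<lambda>t e w. H t e (G t e w))"
proof -
  have *: "continuous_on ({0..1} \<times> sphere 0 1 \<times> UNIV) (\<lambda>p. G (fst p) (fst (snd p)) (snd (snd p)))"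
    using G unfolding fibre_isotopy_def by (simp add: case_prod_beta)
  have "continuous_on ({0..1} \<times> sphere 0 1 \<times> UNIV)
      (\<lambda>p. (\<lambda>(t, e, w). H t e w) (fst p, fst (snd p), G (fst p) (fst (snd p)) (snd (snd p))))"
    by (rule continuous_on_compose2[of "{0..1} \<times> sphere 0 1 \<times> UNIV"])
       (use H in \<open>auto simp: fibre_isotopy_def intro!: continuous_intros *\<close>)
  then have "continuous_on ({0..1} \<times> sphere 0 1 \<times> UNIV) (\<lambda>(t, e, w). H t e (G t e w))"
    by (simp add: case_prod_beta)
  moreover have "inj (\<lambda>w. H t e (G t e w))" if "t \<in> {0..1}" "e \<in> sphere 0 1" for t e
    using G H that inj_compose[of "H t e" "G t e"] unfolding fibre_isotopy_def o_def by blast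
  ultimately show ?thesis
    using G H unfolding fibre_isotopy_def by simp
qed

text \<open>The motion of the disks is extended by the identity outside the tube of radius \<open>c < a\<close> around the core;
the tube stays away from the \<open>z\<close>-axis, where directions are undefined.\<close>
proposition fibre_isotopy_link_equiv:
  assumes G: "fibre_isotopy c G" and c: "0 < c" "c < a"
    and A: "A \<subseteq> sphere 0 1 \<times> cball 0 c"
    and link: "is_link (torus_point a ` fibre_map (G 1) ` A)"
  shows "torus_point a ` A \<simeq>\<^sub>L torus_point a ` fibre_map (G 1) ` A"
proof -
  let ?d = "\<lambda>x. sgn (axis_projection x)" and ?w = "cross_section a"
  define h where "h = (\<lambda>(t, x). if cmod (?w x) \<le> c then torus_point a (?d x, G t (?d x) (?w x)) else x)"
  have cG: "continuous_on ({0..1} \<times> sphere 0 1 \<times> UNIV) (\<lambda>(t, e, w). G t e w)"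
    and injG: "\<And>t e. t \<in> {0..1} \<Longrightarrow> cmod e = 1 \<Longrightarrow> inj (G t e)"
    and idG: "\<And>t e w. c \<le> cmod w \<Longrightarrow> G t e w = w"
    and G0: "\<And>e w. G 0 e w = w"
    using G unfolding fibre_isotopy_def by auto
  have p_nz: "axis_projection x \<noteq> 0" if "cmod (?w x) \<le> c" for x
    using that c abs_Re_le_cmod[of "?w x"] by (auto simp: cross_section_def)
  have d1: "cmod (?d x) = 1" if "cmod (?w x) \<le> c" for x
    using p_nz[OF that] by (simp add: norm_sgn)
  have cont: "continuous_on ({0..1} \<times> UNIV) h"
  proof -
    let ?S = "{p \<in> {0..1} \<times> UNIV. cmod (?w (snd p)) \<le> c}"
    have dc: "continuous_on ?S (\<lambda>p. ?d (snd p))"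
      unfolding sgn_div_norm by (intro continuous_intros) (use p_nz in auto)
    have "continuous_on ?S (\<lambda>p. (\<lambda>(t, e, w). G t e w) (fst p, ?d (snd p), ?w (snd p)))"
      by (rule continuous_on_compose2[OF cG]) (use d1 in \<open>auto intro!: continuous_intros dc\<close>)
    then have gc: "continuous_on ?S (\<lambda>p. G (fst p) (?d (snd p)) (?w (snd p)))"
      by simp
    have "continuous_on ({0..1} \<times> UNIV) (\<lambda>p. if cmod (?w (snd p)) \<le> c
        then torus_point a (?d (snd p), G (fst p) (?d (snd p)) (?w (snd p))) else snd p)"
      by (rule continuous_on_cases_le)
         (use idG in \<open>auto intro!: continuous_intros dc gc simp: torus_point_coordinates\<close>)
    then show ?thesis
      by (simp add: h_def case_prod_beta)
  qed
  have w_h: "?w (h (t, x)) = G t (?d x) (?w x)" "?d (h (t, x)) = ?d x" "cmod (?w (h (t, x))) < c"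
    if "t \<in> {0..1}" "cmod (?w x) < c" for t x
  proof -
    have "cmod (G t (?d x) (?w x)) < c"
      using fibre_isotopy_bounded[OF G that(1) d1 that(2)] that(2) by auto
    then show "?w (h (t, x)) = G t (?d x) (?w x)" "?d (h (t, x)) = ?d x" "cmod (?w (h (t, x))) < c"
      using that(2) d1[of x] c unfolding h_def by (simp_all add: coordinates_torus_point)
  qed
  have h_id: "h (t, x) = x" if "c \<le> cmod (?w x)" for t x
    using that idG by (auto simp: h_def torus_point_coordinates)
  have inj: "inj (\<lambda>x. h (t, x))" if t: "t \<in> {0..1}" for t
  proof (rule injI)
    fix x y assume eq: "h (t, x) = h (t, y)"
    consider "cmod (?w x) < c" "cmod (?w y) < c" | "c \<le> cmod (?w x)" "c \<le> cmod (?w y)"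
      using h_id w_h(3)[OF t] eq by (metis not_le)
    then show "x = y"
    proof cases
      case 1
      then have "?d x = ?d y" "G t (?d x) (?w x) = G t (?d y) (?w y)"
        using eq w_h(1,2)[OF t] by metis+
      then have "?w x = ?w y"
        using injG[OF t d1[of x]] 1 by (simp add: inj_eq)
      then show ?thesis
        using \<open>?d x = ?d y\<close> torus_point_coordinates by metis
    next
      case 2
      then show ?thesis using eq h_id by simp
    qed
  qed
  have image: "(\<lambda>x. h (1, x)) ` torus_point a ` A = torus_point a ` fibre_map (G 1) ` A"
  proof -
    have "h (1, torus_point a (e, w)) = torus_point a (e, G 1 e w)" if "(e, w) \<in> A" for e w
    proof -
      have "cmod e = 1" "cmod w \<le> c" using A that by auto
      then show ?thesis using c by (simp add: h_def coordinates_torus_point)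
    qed
    then show ?thesis
      unfolding image_image fibre_map_def by (intro image_cong) auto
  qed
  have h0: "h (0, x) = x" for x
    by (simp add: h_def G0 torus_point_coordinates)
  have isotopic: "ambient_isotopic (torus_point a ` A) (torus_point a ` fibre_map (G 1) ` A)"
    unfolding image[symmetric]
    by (rule ambient_isotopicI[OF cont h0 inj bounded_tube[of a c]]) (auto intro: h_id)
  have "is_link (torus_point a ` A)"
    using link ambient_isotopic_is_link[OF isotopic] by blast
  then show ?thesis
    using link isotopic unfolding link_equiv_def by blast
qed

section \<open>Torus links as solution sets\<close>
lemma cis_eq_iff: "cis x = cis y \<longleftrightarrow> (\<exists>n::int. x = y + 2 * pi * of_int n)"
  using sin_cos_eq_iff[of x y] by (auto simp: complex_eq_iff)

lemma cis_add_2pi_int [simp]: "cis (x + 2 * pi * of_int n) = cis x"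
  using cis_eq_iff by blast

lemma unit_complex_cis:
  assumes "cmod e = 1"
  obtains \<theta> where "\<theta> \<in> {0..2 * pi}" "e = cis \<theta>"
  using assms that[of "Arg2pi e"] Arg2pi[of e] by (auto simp: cis_conv_exp is_Arg_def)

lemma bezout_nat_int:
  fixes u v :: nat
  obtains p r :: int where "p * int u + r * int v = int (gcd u v)"
  using bezout_int[of "int u" "int v"] by auto

lemma torus_link_component_eq:
  "torus_link_component a b u v k t =
     torus_point a (cis (2 * pi * real (v div gcd u v) * t),
       of_real b * cis (2 * pi * real (u div gcd u v) * t + 2 * pi * real k / real v))"
  unfolding torus_link_component_def tube_point_eq ..

lemma torus_link_component_periodic:
  "torus_link_component a b u v k (t + of_int n) = torus_link_component a b u v k t"
proof -
  have 1: "2 * pi * real p * (t + of_int n) = 2 * pi * real p * t + 2 * pi * of_int (int p * n)" for p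
    by (simp add: algebra_simps)
  have 2: "2 * pi * real p * (t + of_int n) + s = (2 * pi * real p * t + s) + 2 * pi * of_int (int p * n)" for p s
    by (simp add: algebra_simps)
  show ?thesis
    unfolding torus_link_component_eq 2 unfolding 1 cis_add_2pi_int ..
qed

text \<open>Comparing angles gives \<open>v' * (s - t) = A\<close> and \<open>u' * (s - t) + (k - l) / v = B\<close> with integers \<open>A\<close>, \<open>B\<close>,
where \<open>u'\<close> and \<open>v'\<close> are \<open>u\<close> and \<open>v\<close> divided by \<open>d = gcd u v\<close>. Eliminating \<open>s - t\<close> shows that \<open>d\<close> divides
\<open>k - l\<close>, so \<open>k = l\<close>; as \<open>u'\<close> and \<open>v'\<close> are coprime, \<open>s - t\<close> is then an integer.
So the components are disjoint, and each is simple.\<close>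
lemma torus_link_component_eqD:
  assumes ab: "0 < b" "b < a" and v: "v > 0"
    and kl: "k < gcd u v" "l < gcd u v"
    and eq: "torus_link_component a b u v k s = torus_link_component a b u v l t"
  shows "k = l \<and> s - t \<in> \<int>"
proof -
  define d where "d = gcd u v"
  define u' v' where "u' = u div d" and "v' = v div d"
  have d: "d > 0" and u': "u = d * u'" and v': "v = d * v'"
    using v by (auto simp: d_def u'_def v'_def)
  have v'0: "v' > 0" using v v' by (cases v') auto
  have "torus_point a (cis (2 * pi * real v' * s), of_real b * cis (2 * pi * real u' * s + 2 * pi * real k / real v))
      = torus_point a (cis (2 * pi * real v' * t), of_real b * cis (2 * pi * real u' * t + 2 * pi * real l / real v))"
    using eq unfolding torus_link_component_eq u'_def v'_def d_def .
  then have "cis (2 * pi * real v' * s) = cis (2 * pi * real v' * t)"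
    "cis (2 * pi * real u' * s + 2 * pi * real k / real v) = cis (2 * pi * real u' * t + 2 * pi * real l / real v)"
    using ab by (auto simp: torus_point_eq_iff norm_mult)
  then obtain A B :: int where
    "2 * pi * real v' * s = 2 * pi * real v' * t + 2 * pi * of_int A"
    "2 * pi * real u' * s + 2 * pi * real k / real v = 2 * pi * real u' * t + 2 * pi * real l / real v + 2 * pi * of_int B"
    unfolding cis_eq_iff by auto
  then have "2 * pi * (real v' * (s - t)) = 2 * pi * of_int A"
    "2 * pi * (real u' * (s - t) + (real k - real l) / real v) = 2 * pi * of_int B"
    by (simp_all add: algebra_simps diff_divide_distrib)
  then have A: "real v' * (s - t) = of_int A"
    and B: "real u' * (s - t) + (real k - real l) / real v = of_int B"
    by (simp_all only: mult_cancel_left) (use pi_gt_zero in auto)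
  have "real u * of_int A + (real k - real l) = real v * of_int B"
    unfolding A[symmetric] B[symmetric] using v v'0 d by (simp add: u' v' field_simps)
  then have "of_int (int k - int l) = (of_int (int v * B - int u * A) :: real)"
    by simp
  then have "int k - int l = int d * (int v' * B - int u' * A)"
    unfolding of_int_eq_iff by (simp add: u' v' algebra_simps)
  then have "int d dvd int k - int l" by simp
  moreover have "\<bar>int k - int l\<bar> < int d"
    using kl by (auto simp: d_def)
  ultimately have "k = l"
    using dvd_imp_le_int[of "int k - int l" "int d"] by force
  then have B': "real u' * (s - t) = of_int B"
    using B by simp
  obtain p r where "p * int u + r * int v = int d"
    unfolding d_def using bezout_nat_int .
  then have "int d * (p * int u' + r * int v') = int d * 1"
    by (simp add: u' v' algebra_simps)
  then have "p * int u' + r * int v' = 1"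
    using d by (simp only: mult_cancel_left) simp
  then have "(of_int (p * int u' + r * int v') :: real) = 1"
    by simp
  then have "s - t = (of_int p * real u' + of_int r * real v') * (s - t)"
    by simp
  also have "\<dots> = of_int p * (real u' * (s - t)) + of_int r * (real v' * (s - t))"
    by (simp only: algebra_simps)
  also have "\<dots> = of_int (p * B + r * A)"
    unfolding A B' by simp
  finally have "s - t \<in> \<int>"
    by (metis Ints_of_int)
  then show ?thesis
    using \<open>k = l\<close> by simp
qed

lemma is_link_torus_link:
  assumes ab: "0 < b" "b < a" and v: "v > 0"
  shows "is_link (torus_link a b u v)"
proof -
  let ?c = "torus_link_component a b u v"
  note eqD = torus_link_component_eqD[OF ab v]
  have "simple_closed_curve (path_image (?c k))" if k: "k < gcd u v" for k
  proof -
    have "path (?c k)"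
      unfolding path_def torus_link_component_eq[abs_def] cis_conv_exp
      using v by (intro continuous_intros) auto
    moreover have "loop_free (?c k)"
      unfolding loop_free_def
    proof (intro ballI impI)
      fix x y :: real assume xy: "x \<in> {0..1}" "y \<in> {0..1}" "?c k x = ?c k y"
      then obtain n :: int where n: "x - y = of_int n"
        using eqD[OF k k xy(3)] by (metis Ints_cases)
      then have "\<bar>real_of_int n\<bar> \<le> 1" using xy by auto
      then have "n = 0 \<or> n = 1 \<or> n = -1" by linarith
      then show "x = y \<or> x = 0 \<and> y = 1 \<or> x = 1 \<and> y = 0"
        using n xy by auto
    qed
    moreover have "pathfinish (?c k) = pathstart (?c k)"
      unfolding pathfinish_def pathstart_def
      using torus_link_component_periodic[of a b u v k 0 1] by simp
    ultimately show ?thesis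
      unfolding simple_closed_curve_def simple_path_def by blast
  qed
  moreover have "pairwise disjnt ((\<lambda>k. path_image (?c k)) ` {..<gcd u v})"
    unfolding pairwise_image pairwise_def disjnt_def path_image_def
    using eqD by blast
  ultimately show ?thesis
    unfolding is_link_def torus_link_def
    by (intro exI[of _ "(\<lambda>k. path_image (?c k)) ` {..<gcd u v}"]) auto
qed

text \<open>In angles, the last equation reads \<open>v * \<phi> - u * \<theta> \<in> 2 * pi * \<int>\<close>.\<close>
definition torus_link_fibration :: "real \<Rightarrow> nat \<Rightarrow> nat \<Rightarrow> (complex \<times> complex) set" where
  "torus_link_fibration b u v = {(e, w). cmod e = 1 \<and> cmod w = b \<and> w ^ v = of_real b ^ v * e ^ u}"

text \<open>Given a solution with \<open>v * \<phi> - u * \<theta> = 2 * pi * l\<close>, the component containing it is the residue \<open>k\<close> of \<open>l\<close>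
modulo \<open>d = gcd u v\<close>. Adding full turns to \<open>\<theta>\<close> changes \<open>l\<close> by multiples of \<open>u\<close>, adding them to \<open>\<phi>\<close>
changes it by multiples of \<open>v\<close>, and Bezout's identity reaches \<open>k\<close> from \<open>l\<close> in this way.\<close>
lemma torus_link_eq_fibration:
  assumes b: "0 < b" and v: "v > 0"
  shows "torus_link a b u v = torus_point a ` torus_link_fibration b u v"
proof (intro equalityI subsetI)
  fix x assume "x \<in> torus_link a b u v"
  then obtain k t where x: "x = torus_link_component a b u v k t"
    unfolding torus_link_def path_image_def by blast
  define d where "d = gcd u v"
  let ?e = "cis (2 * pi * real (v div d) * t)"
  let ?w = "of_real b * cis (2 * pi * real (u div d) * t + 2 * pi * real k / real v)"
  have "real v * real (u div d) = real u * real (v div d)"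
    unfolding of_nat_mult[symmetric] of_nat_eq_iff d_def by (simp add: div_mult_swap dvd_div_mult mult.commute)
  then have "real v * (2 * pi * real (u div d) * t + 2 * pi * real k / real v)
      = real u * (2 * pi * real (v div d) * t) + 2 * pi * of_int (int k)"
    using v by (simp add: distrib_left)
  then have "cis (real v * (2 * pi * real (u div d) * t + 2 * pi * real k / real v))
      = cis (real u * (2 * pi * real (v div d) * t))"
    by (simp only: cis_add_2pi_int)
  then have "cis (2 * pi * real (u div d) * t + 2 * pi * real k / real v) ^ v
      = cis (2 * pi * real (v div d) * t) ^ u"
    unfolding Complex.DeMoivre .
  then have "(?e, ?w) \<in> torus_link_fibration b u v"
    using b by (simp add: torus_link_fibration_def norm_mult power_mult_distrib)
  then show "x \<in> torus_point a ` torus_link_fibration b u v"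
    unfolding x torus_link_component_eq d_def by blast
next
  fix x assume "x \<in> torus_point a ` torus_link_fibration b u v"
  then obtain e w where x: "x = torus_point a (e, w)"
    and ew: "cmod e = 1" "cmod w = b" "w ^ v = of_real b ^ v * e ^ u"
    unfolding torus_link_fibration_def by auto
  obtain \<theta> where e: "e = cis \<theta>"
    using unit_complex_cis[OF ew(1)] .
  have "cmod (w / of_real b) = 1"
    using ew(2) b by (simp add: norm_divide)
  then obtain \<phi> where "w / of_real b = cis \<phi>"
    by (rule unit_complex_cis)
  then have w: "w = of_real b * cis \<phi>"
    using b by (auto simp: field_simps)
  have "cis (real v * \<phi>) = cis (real u * \<theta>)"
    using ew(3) b unfolding e w by (simp add: power_mult_distrib Complex.DeMoivre)
  then obtain l :: int where l: "real v * \<phi> = real u * \<theta> + 2 * pi * of_int l"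
    unfolding cis_eq_iff by blast
  define d where "d = gcd u v"
  define u' v' where "u' = u div d" and "v' = v div d"
  have d: "d > 0" and u': "u = d * u'" and v': "v = d * v'"
    using v by (auto simp: d_def u'_def v'_def)
  obtain p r where pr: "p * int u + r * int v = int d"
    unfolding d_def using bezout_nat_int .
  define k where "k = nat (l mod int d)"
  define j where "j = l div int d"
  have k: "k < d" "l = int k + int d * j"
    using d by (simp_all add: k_def j_def nat_less_iff)
  then have l_eq: "l = int k + (p * j) * int u + (r * j) * int v"
    by (simp add: pr[symmetric] algebra_simps)
  define t where "t = (\<theta> + 2 * pi * of_int (p * j)) / (2 * pi * real v')"
  have v'0: "v' > 0" using v v' by (cases v') auto
  have t: "2 * pi * real v' * t = \<theta> + 2 * pi * of_int (p * j)"
    using v'0 by (simp add: t_def)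
  have "real v * (2 * pi * real u' * t) = real u * (2 * pi * real v' * t)"
    by (simp add: u' v')
  also have "\<dots> = real u * \<theta> + 2 * pi * of_int (p * j * int u)"
    unfolding t by (simp add: algebra_simps)
  also have "\<dots> = real v * \<phi> - 2 * pi * of_int (int k + (r * j) * int v)"
    using l unfolding l_eq by (simp add: algebra_simps)
  also have "\<dots> = real v * (\<phi> - 2 * pi * real k / real v - 2 * pi * of_int (r * j))"
    using v by (simp add: algebra_simps)
  finally have "2 * pi * real u' * t = \<phi> - 2 * pi * real k / real v - 2 * pi * of_int (r * j)"
    using v by simp
  then have s: "\<phi> = 2 * pi * real u' * t + 2 * pi * real k / real v + 2 * pi * of_int (r * j)"
    by simp
  have "x = torus_link_component a b u v k t"
    unfolding x torus_link_component_eq d_def[symmetric] u'_def[symmetric] v'_def[symmetric] t e w s cis_add_2pi_int ..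
  also have "\<dots> = torus_link_component a b u v k (frac t)"
    using torus_link_component_periodic[of a b u v k "frac t" "\<lfloor>t\<rfloor>"] by (simp add: frac_def)
  finally show "x \<in> torus_link a b u v"
    using k(1) frac_ge_0[of t] frac_lt_1[of t] unfolding torus_link_def path_image_def d_def
    by (force intro: less_imp_le)
qed

lemma torus_core_eq: "torus_core a = torus_point a ` (sphere 0 1 \<times> {0})"
proof -
  have "cis ` {0..2 * pi} = sphere 0 1"
    by (auto elim!: unit_complex_cis)
  then have "sphere 0 1 \<times> {0::complex} = (\<lambda>\<theta>. (cis \<theta>, 0)) ` {0..2 * pi}"
    by auto
  then show ?thesis
    unfolding torus_core_def tube_point_eq by (simp add: image_image)
qed

lemma is_link_torus_core:
  assumes "0 < a"
  shows "is_link (torus_core a)"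
proof -
  let ?\<gamma> = "\<lambda>t. torus_point a (cis (2 * pi * t), 0)"
  have image: "path_image ?\<gamma> = torus_core a"
  proof -
    have "(\<lambda>t. 2 * pi * t) ` {0..1} = {0..2 * pi}"
      using image_mult_atLeastAtMost[of "2 * pi" 0 1] by simp
    then show ?thesis
      unfolding path_image_def torus_core_def tube_point_eq
      by (metis (no_types, lifting) image_image image_cong mult_zero_left of_real_0)
  qed
  have "path ?\<gamma>"
    unfolding path_def cis_conv_exp by (intro continuous_intros)
  moreover have "loop_free ?\<gamma>"
    unfolding loop_free_def
  proof (intro ballI impI)
    fix x y :: real assume xy: "x \<in> {0..1}" "y \<in> {0..1}" "?\<gamma> x = ?\<gamma> y"
    then have "cis (2 * pi * x) = cis (2 * pi * y)"
      using assms by (simp add: torus_point_eq_iff)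
    then obtain n :: int where "2 * pi * x = 2 * pi * y + 2 * pi * of_int n"
      unfolding cis_eq_iff by blast
    then have "2 * pi * x = 2 * pi * (y + of_int n)"
      by (simp add: algebra_simps)
    then have n: "x = y + of_int n"
      by simp
    then have "\<bar>real_of_int n\<bar> \<le> 1" using xy by auto
    then have "n = 0 \<or> n = 1 \<or> n = -1" by linarith
    then show "x = y \<or> x = 0 \<and> y = 1 \<or> x = 1 \<and> y = 0"
      using n xy by auto
  qed
  moreover have "pathfinish ?\<gamma> = pathstart ?\<gamma>"
    by (simp add: pathfinish_def pathstart_def)
  ultimately have "simple_closed_curve (torus_core a)"
    unfolding simple_closed_curve_def simple_path_def using image by blast
  then show ?thesis
    unfolding is_link_def by (intro exI[of _ "{torus_core a}"]) simp
qed

lemma is_link_torus_link_Un_core: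
  assumes "0 < b" "b < a" "v > 0"
  shows "is_link (torus_link a b u v \<union> torus_core a)"
proof (rule is_link_Un[OF is_link_torus_link is_link_torus_core])
  have "0 < a" using assms by simp
  show "torus_link a b u v \<inter> torus_core a = {}"
  proof (intro equals0I)
    fix x assume "x \<in> torus_link a b u v \<inter> torus_core a"
    then have "x \<in> torus_point a ` torus_link_fibration b u v" "x \<in> torus_point a ` (sphere 0 1 \<times> {0})"
      unfolding torus_link_eq_fibration[OF assms(1,3)] torus_core_eq by simp_all
    then obtain p p' where "x = torus_point a p" "p \<in> torus_link_fibration b u v"
        "x = torus_point a p'" "p' \<in> sphere 0 1 \<times> {0}"
      by blast
    moreover obtain e w e' w' where "p = (e, w)" "p' = (e', w')"
      by (cases p, cases p')
    ultimately show False
      unfolding torus_link_fibration_def using torus_point_eq_iff[of e w a e' w'] assms \<open>0 < a\<close> by auto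
  qed
qed (use assms in auto)

section \<open>Three elementary motions of the disks\<close>

text \<open>The only discontinuity of \<open>Arg2pi\<close> on the circle is the jump from \<open>2 * pi\<close> to \<open>0\<close>, which \<open>g\<close> does not see.\<close>
lemma periodic_function_on_circle:
  fixes g :: "real \<Rightarrow> real"
  assumes cont: "continuous_on {0..2 * pi} g" and per: "g (2 * pi) = g 0"
  obtains D where "continuous_on (sphere 0 1) D" "\<And>\<theta>. \<theta> \<in> {0..2 * pi} \<Longrightarrow> D (cis \<theta>) = g \<theta>"
proof
  let ?p = "\<lambda>t. g (2 * pi * t)"
  have "path ?p"
    unfolding path_def
    by (rule continuous_on_compose2[OF cont]) (auto intro!: continuous_intros mult_left_le)
  then have "homotopic_loops UNIV ?p ?p"
    using per by (simp add: homotopic_loops_refl pathfinish_def pathstart_def)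
  then have "continuous_on (sphere 0 1) (?p \<circ> (\<lambda>z. Arg2pi z / (2 * pi)))"
    using homotopic_loops_imp_homotopic_circlemaps homotopic_with_imp_continuous by blast
  then show "continuous_on (sphere 0 1) (g \<circ> Arg2pi)"
    by (simp add: o_def)
  fix \<theta> :: real assume \<theta>: "\<theta> \<in> {0..2 * pi}"
  show "(g \<circ> Arg2pi) (cis \<theta>) = g \<theta>"
  proof (cases "\<theta> = 2 * pi")
    case True
    then show ?thesis using per by (simp add: Arg2pi_of_real[of 1, simplified])
  next
    case False
    then have "Arg2pi (cis \<theta>) = \<theta>"
      using \<theta> by (intro Arg2pi_unique[of 1]) (auto simp: cis_conv_exp)
    then show ?thesis by simp
  qed
qed

lemma fibre_isotopyI:
  assumes "continuous_on ({0..1} \<times> sphere 0 1 \<times> UNIV) (\<lambda>p. G (fst p) (fst (snd p)) (snd (snd p)))"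
    and "\<And>t e w w'. 0 \<le> t \<Longrightarrow> t \<le> 1 \<Longrightarrow> cmod e = 1 \<Longrightarrow> G t e w = G t e w' \<Longrightarrow> w = w'"
    and "\<And>t e w. c \<le> cmod w \<Longrightarrow> G t e w = w"
    and "\<And>e w. G 0 e w = w"
  shows "fibre_isotopy c G"
proof -
  have "continuous_on ({0..1} \<times> sphere 0 1 \<times> UNIV) (\<lambda>(t, e, w). G t e w)"
    using assms(1) by (simp add: case_prod_beta)
  moreover have "inj (G t e)" if "t \<in> {0..1}" "e \<in> sphere 0 1" for t e
    by (rule injI, rule assms(2)[of t e]) (use that in auto)
  ultimately show ?thesis
    unfolding fibre_isotopy_def using assms(3,4) by blast
qed

text \<open>Moduli are preserved, so both sides of an equation between images are rotated by the same angle.\<close>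
lemma fibre_isotopy_twist:
  assumes cont: "continuous_on (sphere 0 1 \<times> UNIV) (\<lambda>p. \<psi> (fst p) (snd p))"
    and zero: "\<And>e r. c \<le> r \<Longrightarrow> \<psi> e r = 0"
  shows "fibre_isotopy c (\<lambda>t e w. w * cis (t * \<psi> e (cmod w)))"
proof (rule fibre_isotopyI)
  have "continuous_on ({0..1} \<times> sphere 0 1 \<times> UNIV)
      (\<lambda>p. (\<lambda>p. \<psi> (fst p) (snd p)) (fst (snd p), cmod (snd (snd p))))"
    by (rule continuous_on_compose2[OF cont]) (auto intro!: continuous_intros)
  then show "continuous_on ({0..1} \<times> sphere 0 1 \<times> UNIV)
      (\<lambda>p. snd (snd p) * cis (fst p * \<psi> (fst (snd p)) (cmod (snd (snd p)))))"
    unfolding cis_conv_exp by (auto intro!: continuous_intros)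
  fix t e w w'
  assume eq: "w * cis (t * \<psi> e (cmod w)) = w' * cis (t * \<psi> e (cmod w'))"
  then have "cmod (w * cis (t * \<psi> e (cmod w))) = cmod (w' * cis (t * \<psi> e (cmod w')))"
    by simp
  then have "cmod w = cmod w'"
    by (simp add: norm_mult)
  then show "w = w'"
    using eq by simp
qed (use zero in auto)

text \<open>The displacement is a function of \<open>w\<close> with Lipschitz constant \<open>\<bar>v\<bar> / c < 1\<close>, hence the map is injective.\<close>
lemma fibre_isotopy_shift:
  assumes v: "\<bar>v\<bar> < c"
  shows "fibre_isotopy c (\<lambda>t e w. w + of_real (t * v * max 0 (1 - cmod w / c)) * e ^ M)"
proof (rule fibre_isotopyI)
  have c: "c > 0" using v by linarith
  show "continuous_on ({0..1} \<times> sphere 0 1 \<times> UNIV)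
      (\<lambda>p. snd (snd p) + of_real (fst p * v * max 0 (1 - cmod (snd (snd p)) / c)) * fst (snd p) ^ M)"
    using c by (auto intro!: continuous_intros)
  fix t :: real and e w w' :: complex
  let ?k = "\<lambda>w. max 0 (1 - cmod w / c)"
  assume t: "0 \<le> t" "t \<le> 1" and e: "cmod e = 1"
    and eq: "w + of_real (t * v * ?k w) * e ^ M = w' + of_real (t * v * ?k w') * e ^ M"
  have "\<bar>?k w' - ?k w\<bar> \<le> \<bar>cmod w / c - cmod w' / c\<bar>"
    by (simp add: max_def)
  also have "\<dots> = \<bar>cmod w - cmod w'\<bar> / c"
    using c by (simp add: diff_divide_distrib[symmetric])
  also have "\<dots> \<le> cmod (w - w') / c"
    using c by (intro divide_right_mono norm_triangle_ineq3) simp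
  finally have lip: "\<bar>?k w' - ?k w\<bar> \<le> cmod (w - w') / c" .
  have "w - w' = of_real (t * v * (?k w' - ?k w)) * e ^ M"
    using eq by (simp add: algebra_simps)
  then have "cmod (w - w') = t * \<bar>v\<bar> * \<bar>?k w' - ?k w\<bar>"
    using t e by (simp add: norm_mult norm_power abs_mult del: of_real_diff of_real_mult)
  also have "\<dots> \<le> 1 * \<bar>v\<bar> * (cmod (w - w') / c)"
    using t lip by (intro mult_mono) auto
  finally have "cmod (w - w') * c \<le> \<bar>v\<bar> * cmod (w - w')"
    using c by (simp add: field_simps)
  then show "w = w'"
    using v by (smt (verit) mult.commute mult_le_cancel_right norm_ge_zero right_minus_eq zero_less_norm_iff)
next
  fix t e w assume "c \<le> cmod w"
  moreover have "c > 0" using v by linarith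
  ultimately show "w + of_real (t * v * max 0 (1 - cmod w / c)) * e ^ M = w"
    by (simp add: max_def)
qed auto

text \<open>The piecewise linear function with value \<open>1\<close> at \<open>p\<close> that vanishes outside \<open>{\<epsilon>..c}\<close>. Adding a multiple
\<open>p' - p\<close> of it to the identity gives the piecewise linear map that fixes \<open>\<epsilon>\<close> and \<open>c\<close> and sends \<open>p\<close> to \<open>p'\<close>.\<close>
definition tent :: "real \<Rightarrow> real \<Rightarrow> real \<Rightarrow> real \<Rightarrow> real" where
  "tent \<epsilon> p c r = max 0 (min ((r - \<epsilon>) / (p - \<epsilon>)) ((c - r) / (c - p)))"

lemma tent_simps:
  assumes "\<epsilon> < p" "p < c"
  shows "r \<le> \<epsilon> \<Longrightarrow> tent \<epsilon> p c r = 0" "c \<le> r \<Longrightarrow> tent \<epsilon> p c r = 0" "tent \<epsilon> p c p = 1"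
proof -
  show "tent \<epsilon> p c r = 0" if "r \<le> \<epsilon>"
    unfolding tent_def using that assms by (intro max_absorb1 min.coboundedI1) (simp add: divide_le_0_iff)
  show "tent \<epsilon> p c r = 0" if "c \<le> r"
    unfolding tent_def using that assms by (intro max_absorb1 min.coboundedI2) (simp add: divide_le_0_iff)
qed (use assms in \<open>simp add: tent_def\<close>)

text \<open>On each of the three pieces the map has positive slope. The proof avoids locating \<open>r\<close> and \<open>r'\<close> on the pieces:
the displacement is built with \<open>max\<close> and \<open>min\<close> from three functions, each of which
gives a strictly increasing map when added to the identity.\<close>
lemma tent_displacement_strict_mono:
  assumes p: "\<epsilon> < p" "p < c" and p': "\<epsilon> < p + \<tau>" "p + \<tau> < c" and r: "r < r'"
  shows "r + \<tau> * tent \<epsilon> p c r < r' + \<tau> * tent \<epsilon> p c r'"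
proof -
  define A where "A = (\<lambda>r. (r - \<epsilon>) / (p - \<epsilon>))"
  define B where "B = (\<lambda>r. (c - r) / (c - p))"
  have A: "r + \<tau> * A r < r' + \<tau> * A r'"
  proof -
    define s where "s = (r' - r) / (p - \<epsilon>)"
    have s: "s > 0" "r' = r + s * (p - \<epsilon>)"
      using p r by (simp_all add: s_def)
    have "0 < s * (p + \<tau> - \<epsilon>)"
      using p' s by simp
    then have "0 < s * (p - \<epsilon>) + \<tau> * s"
      by (simp add: algebra_simps)
    moreover have "A r' = A r + s"
      by (simp add: s_def A_def diff_divide_distrib)
    then have "\<tau> * A r' = \<tau> * A r + \<tau> * s"
      by (simp only: distrib_left right_diff_distrib)
    ultimately show ?thesis using s(2) by linarith
  qed
  have B: "r + \<tau> * B r < r' + \<tau> * B r'"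
  proof -
    define s where "s = (r' - r) / (c - p)"
    have s: "s > 0" "r' = r + s * (c - p)"
      using p r by (simp_all add: s_def)
    have "0 < s * (c - (p + \<tau>))"
      using p' s by simp
    then have "0 < s * (c - p) - \<tau> * s"
      by (simp add: algebra_simps)
    moreover have "B r' = B r - s"
      by (simp add: s_def B_def diff_divide_distrib)
    then have "\<tau> * B r' = \<tau> * B r - \<tau> * s"
      by (simp only: distrib_left right_diff_distrib)
    ultimately show ?thesis using s(2) by linarith
  qed
  have tent: "tent \<epsilon> p c s = max 0 (min (A s) (B s))" for s
    by (simp add: tent_def A_def B_def)
  show ?thesis
  proof (cases "0 \<le> \<tau>")
    case True
    then have "\<tau> * tent \<epsilon> p c s = max 0 (min (\<tau> * A s) (\<tau> * B s))" for s
      by (simp add: tent max_mult_distrib_left min_mult_distrib_left)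
    then show ?thesis
      using A B r by (simp add: max_def min_def)
  next
    case False
    then have "\<tau> * tent \<epsilon> p c s = min 0 (max (\<tau> * A s) (\<tau> * B s))" for s
      by (simp add: tent max_mult_distrib_left min_mult_distrib_left)
    then show ?thesis
      using A B r by (simp add: max_def min_def)
  qed
qed

lemma continuous_on_tent [continuous_intros]:
  assumes "continuous_on S f" "continuous_on S g" "\<And>x. x \<in> S \<Longrightarrow> \<epsilon> < f x" "\<And>x. x \<in> S \<Longrightarrow> f x < c"
  shows "continuous_on S (\<lambda>x. tent \<epsilon> (f x) c (g x))"
  unfolding tent_def by (intro continuous_intros assms) (use assms(3,4) in force)+

text \<open>On the ray in direction \<open>u\<close> the radius \<open>p\<close> is moved to \<open>(1 - t) * p + t * b\<close>, where
\<open>p\<close> depends on \<open>u ^ q / e ^ M\<close> only: the points with \<open>w ^ q = z ^ q * e ^ M\<close> for a given \<open>z\<close> are then all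
moved alike, for every \<open>e\<close>. As \<open>e\<close> has modulus \<open>1\<close>, its inverse is its conjugate. The \<open>max\<close> makes \<open>u\<close> continuous
at the core; it differs from the direction only where the displacement is \<open>0\<close>.\<close>
definition radial_stretch ::
  "real \<Rightarrow> real \<Rightarrow> real \<Rightarrow> (complex \<Rightarrow> real) \<Rightarrow> nat \<Rightarrow> nat \<Rightarrow> real \<Rightarrow> complex \<Rightarrow> complex \<Rightarrow> complex" where
  "radial_stretch \<epsilon> b c \<rho> q M t e w =
     (let u = w / of_real (max \<epsilon> (cmod w)); p = \<rho> (u ^ q * cnj e ^ M)
      in w + of_real (t * (b - p) * tent \<epsilon> p c (cmod w)) * u)"

lemma radial_stretch_inner:
  assumes "\<And>z. \<epsilon> < \<rho> z" "\<And>z. \<rho> z < c" "cmod w \<le> \<epsilon>"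
  shows "radial_stretch \<epsilon> b c \<rho> q M t e w = w"
  using assms by (simp add: radial_stretch_def Let_def tent_simps)

lemma radial_stretch_outer:
  assumes "0 < \<epsilon>" "\<epsilon> \<le> r" "cmod u = 1"
  shows "radial_stretch \<epsilon> b c \<rho> q M t e (of_real r * u) =
    of_real (r + t * (b - \<rho> (u ^ q * cnj e ^ M)) * tent \<epsilon> (\<rho> (u ^ q * cnj e ^ M)) c r) * u"
  using assms by (simp add: radial_stretch_def Let_def norm_mult max_absorb2 distrib_right)

text \<open>The map preserves the disk of radius \<open>\<epsilon>\<close>, where it is the identity, and the rays outside it, on each of which it
is strictly increasing.\<close>
lemma fibre_isotopy_radial_stretch:
  assumes \<epsilon>: "0 < \<epsilon>" and b: "\<epsilon> < b" "b < c"
    and \<rho>: "continuous_on UNIV \<rho>" "\<And>z. \<epsilon> < \<rho> z" "\<And>z. \<rho> z < c"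
  shows "fibre_isotopy c (radial_stretch \<epsilon> b c \<rho> q M)"
proof (rule fibre_isotopyI)
  have \<rho>c: "continuous_on S (\<lambda>x. \<rho> (f x))" if "continuous_on S f" for f :: "real \<times> complex \<times> complex \<Rightarrow> complex" and S
    by (rule continuous_on_compose2[OF \<rho>(1) that]) simp
  have nz: "of_real (max \<epsilon> (cmod w)) \<noteq> (0::complex)" for w
    using \<epsilon> by (auto simp: max_def)
  show "continuous_on ({0..1} \<times> sphere 0 1 \<times> UNIV)
      (\<lambda>p. radial_stretch \<epsilon> b c \<rho> q M (fst p) (fst (snd p)) (snd (snd p)))"
    unfolding radial_stretch_def Let_def
    by (intro continuous_intros \<rho>c) (use nz \<rho> in auto)
  fix t :: real and e w w' :: complex
  assume t: "0 \<le> t" "t \<le> 1" and eq: "radial_stretch \<epsilon> b c \<rho> q M t e w = radial_stretch \<epsilon> b c \<rho> q M t e w'"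
  let ?G = "radial_stretch \<epsilon> b c \<rho> q M t e"
  define p where "p = (\<lambda>u. \<rho> (u ^ q * cnj e ^ M))"
  define F where "F = (\<lambda>u r. r + t * (b - p u) * tent \<epsilon> (p u) c r)"
  have G: "?G (of_real r * u) = of_real (F u r) * u" if "\<epsilon> \<le> r" "cmod u = 1" for r u
    unfolding F_def p_def by (rule radial_stretch_outer[OF \<epsilon> that])
  have "p u + t * (b - p u) = (1 - t) * p u + t * b" for u
    by (simp add: algebra_simps)
  moreover have "\<epsilon> < (1 - t) * p u + t * b" "(1 - t) * p u + t * b < c" for u
    using convex_bound_lt[of "- p u" "- \<epsilon>" "- b" "1 - t" t] convex_bound_lt[of "p u" c b "1 - t" t]
      \<rho>(2,3) b t unfolding p_def by auto
  ultimately have mono: "F u r < F u r'" if "r < r'" for u r r'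
    unfolding F_def using \<rho>(2,3) that by (intro tent_displacement_strict_mono) (auto simp: p_def)
  have F_\<epsilon>: "F u \<epsilon> = \<epsilon>" for u
    using \<rho>(2,3) by (simp add: F_def p_def tent_simps)
  have F_ge: "\<epsilon> \<le> F u r" if "\<epsilon> \<le> r" for u r
    using mono[of \<epsilon> r u] that F_\<epsilon>[of u] by (cases "r = \<epsilon>") auto
  have polar: "\<exists>r u. w = of_real r * u \<and> \<epsilon> \<le> r \<and> cmod u = 1" if "\<epsilon> \<le> cmod w" for w
    using that \<epsilon> by (intro exI[of _ "cmod w"] exI[of _ "sgn w"]) (auto simp: sgn_eq norm_divide)
  have outer: "\<epsilon> \<le> cmod (?G w)" if w_ge: "\<epsilon> \<le> cmod w" for w
  proof -
    obtain r u where w: "w = of_real r * u" "\<epsilon> \<le> r" "cmod u = 1"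
      using polar[OF w_ge] by blast
    then show ?thesis
      using F_ge[of r u] \<epsilon> by (simp add: G norm_mult)
  qed
  have inner: "?G w = w" if "cmod w < \<epsilon>" for w
    using \<rho> that by (simp add: radial_stretch_inner)
  consider "cmod w < \<epsilon>" "cmod w' < \<epsilon>" | "\<epsilon> \<le> cmod w" "\<epsilon> \<le> cmod w'"
    using eq inner outer by (metis not_le)
  then show "w = w'"
  proof cases
    case 1
    then show ?thesis using eq inner by simp
  next
    case 2
    obtain r u where w: "w = of_real r * u" "\<epsilon> \<le> r" "cmod u = 1"
      using polar[OF 2(1)] by blast
    obtain r' u' where w': "w' = of_real r' * u'" "\<epsilon> \<le> r'" "cmod u' = 1"
      using polar[OF 2(2)] by blast
    have FF: "of_real (F u r) * u = of_real (F u' r') * u'"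
      using eq w w' by (simp add: G)
    then have "cmod (of_real (F u r) * u) = cmod (of_real (F u' r') * u')"
      by simp
    then have F: "F u r = F u' r'"
      using F_ge[OF w(2), of u] F_ge[OF w'(2), of u'] \<epsilon> w w' by (simp add: norm_mult)
    moreover have "F u r \<noteq> 0"
      using F_ge[OF w(2), of u] \<epsilon> by simp
    ultimately have "u = u'"
      using FF by simp
    then have "r = r'"
      using F mono[of r r' u] mono[of r' r u] by (cases r r' rule: linorder_cases) auto
    then show ?thesis
      using w w' \<open>u = u'\<close> by simp
  qed
next
  fix t e w assume w: "c \<le> cmod w"
  then show "radial_stretch \<epsilon> b c \<rho> q M t e w = w"
    using \<rho> by (simp add: radial_stretch_def Let_def tent_simps)
next
  fix e w show "radial_stretch \<epsilon> b c \<rho> q M 0 e w = w"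
    by (simp add: radial_stretch_def Let_def)
qed

section \<open>From powers to torus links\<close>
definition power_fibration :: "(complex set) \<Rightarrow> nat \<Rightarrow> nat \<Rightarrow> (complex \<times> complex) set" where
  "power_fibration Z q M = {(e, w). cmod e = 1 \<and> (\<exists>z\<in>Z. w ^ q = z ^ q * e ^ M)}"

lemma power_fibration_modulus:
  assumes "q > 0" "cmod e = 1" "w ^ q = z ^ q * e ^ M"
  shows "cmod w = cmod z"
proof -
  have "cmod w ^ q = cmod z ^ q"
    using arg_cong[OF assms(3), of cmod] assms(2) by (simp add: norm_mult norm_power)
  then show ?thesis
    using assms(1) power_eq_iff_eq_base[of q "cmod w" "cmod z"] by simp
qed

text \<open>Since the \<open>k\<close> moduli are different, one continuous function of the modulus can prescribe all the angles by
which the points turn. The \<open>q\<close> points over each \<open>x j\<close> are equally spaced, so it is enough that the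
new arguments are the first \<open>k\<close> of the \<open>q * k\<close> equally spaced ones.\<close>
lemma fan_out:
  fixes x :: "nat \<Rightarrow> complex"
  assumes q: "q > 0" and c: "0 < c"
    and x: "\<And>j. j < k \<Longrightarrow> x j \<noteq> 0" "\<And>j. j < k \<Longrightarrow> cmod (x j) < c"
    and inj: "inj_on (\<lambda>j. cmod (x j)) {..<k}"
  obtains G where "fibre_isotopy c G"
    "fibre_map (G 1) ` power_fibration (x ` {..<k}) q M =
       power_fibration ((\<lambda>j. of_real (cmod (x j)) * cis (2 * pi * real j / real (q * k))) ` {..<k}) q M"
    "\<And>e. G 1 e 0 = 0"
proof -
  let ?r = "\<lambda>j. cmod (x j)"
  let ?y = "\<lambda>j. of_real (?r j) * cis (2 * pi * real j / real (q * k))"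
  \<comment> \<open>Prescribing the angle \<open>0\<close> at radius \<open>c\<close> lets the extension be continued by \<open>0\<close> beyond \<open>c\<close>.\<close>
  let ?S = "insert c (?r ` {..<k})"
  define f where "f = (\<lambda>r. if r = c then 0 else
      let j = the_inv_into {..<k} ?r r in 2 * pi * real j / real (q * k) - Arg (x j))"
  have f: "f (?r j) = 2 * pi * real j / real (q * k) - Arg (x j)" if "j < k" for j
    using the_inv_into_f_f[OF inj, of j] that x(2)[OF that] by (simp add: f_def)
  have "continuous_on ?S f"
    by (intro continuous_on_finite) simp
  then obtain g where g: "continuous_on UNIV g" "\<And>r. r \<in> ?S \<Longrightarrow> g r = f r"
    using Tietze_unbounded[of ?S f UNIV] by (auto simp: finite_imp_closed)
  define \<psi> where "\<psi> = (\<lambda>r. g (min r c))"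
  have \<psi>: "\<psi> (?r j) = 2 * pi * real j / real (q * k) - Arg (x j)" if "j < k" for j
    using x(2)[OF that] g(2)[of "?r j"] f[OF that] that by (simp add: \<psi>_def min_def)
  have turn: "(x j * cis (\<psi> (?r j))) = ?y j" if "j < k" for j
  proof -
    have "x j = of_real (?r j) * cis (Arg (x j))"
      using rcis_cmod_Arg[of "x j"] by (simp add: rcis_def)
    then have "x j * cis (\<psi> (?r j)) = of_real (?r j) * (cis (Arg (x j)) * cis (\<psi> (?r j)))"
      by (metis mult.assoc)
    then show ?thesis
      by (simp add: cis_mult \<psi>[OF that])
  qed
  define G where "G = (\<lambda>t (e::complex) w. w * cis (t * \<psi> (cmod w)))"
  have "fibre_isotopy c G"
    unfolding G_def
  proof (rule fibre_isotopy_twist)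
    show "continuous_on (sphere 0 1 \<times> UNIV) (\<lambda>p. \<psi> (snd p))"
      unfolding \<psi>_def by (rule continuous_on_compose2[OF g(1)]) (auto intro!: continuous_intros)
    show "\<psi> r = 0" if "c \<le> r" for r
      using that g(2)[of c] by (simp add: \<psi>_def f_def min_def)
  qed
  moreover have "fibre_map (G 1) ` power_fibration (x ` {..<k}) q M = power_fibration (?y ` {..<k}) q M"
  proof (intro equalityI subsetI)
    fix p assume "p \<in> fibre_map (G 1) ` power_fibration (x ` {..<k}) q M"
    then obtain e w j where p: "p = (e, w * cis (\<psi> (cmod w)))" and e: "cmod e = 1"
      and j: "j < k" "w ^ q = x j ^ q * e ^ M"
      by (auto simp: fibre_map_def power_fibration_def G_def)
    have "cmod w = ?r j"
      using power_fibration_modulus[OF q e j(2)] .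
    then have "(w * cis (\<psi> (cmod w))) ^ q = ?y j ^ q * e ^ M"
      unfolding turn[OF j(1), symmetric] by (simp add: power_mult_distrib j(2))
    then show "p \<in> power_fibration (?y ` {..<k}) q M"
      using e j(1) unfolding p power_fibration_def by blast
  next
    fix p assume "p \<in> power_fibration (?y ` {..<k}) q M"
    then obtain e w j where p: "p = (e, w)" and e: "cmod e = 1"
      and j: "j < k" "w ^ q = ?y j ^ q * e ^ M"
      unfolding power_fibration_def by blast
    define w' where "w' = w * cis (- \<psi> (?r j))"
    have "cmod w = ?r j"
      using power_fibration_modulus[OF q e j(2)] by (simp add: norm_mult)
    then have w: "w = w' * cis (\<psi> (cmod w'))"
      by (simp add: w'_def norm_mult mult.assoc cis_mult)
    have "w' ^ q = (?y j * cis (- \<psi> (?r j))) ^ q * e ^ M"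
      unfolding w'_def power_mult_distrib j(2) by (simp add: mult_ac)
    also have "?y j * cis (- \<psi> (?r j)) = x j"
      unfolding turn[OF j(1), symmetric] by (simp add: mult.assoc cis_mult)
    finally have "(e, w') \<in> power_fibration (x ` {..<k}) q M"
      using e j(1) unfolding power_fibration_def by blast
    moreover have "p = fibre_map (G 1) (e, w')"
      by (simp add: p fibre_map_def G_def w[symmetric])
    ultimately show "p \<in> fibre_map (G 1) ` power_fibration (x ` {..<k}) q M"
      by blast
  qed
  moreover have "G 1 e 0 = 0" for e
    by (simp add: G_def)
  ultimately show ?thesis using that by blast
qed

text \<open>Here all points lie in different directions: \<open>u ^ q / e ^ M\<close> is the \<open>j\<close>-th of the \<open>k\<close>-th roots of unity for the \<open>q\<close> points of
modulus \<open>r j\<close>. A radial stretch that takes \<open>r j\<close> to \<open>b\<close> in these directions yields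
\<open>w = b * u\<close> where \<open>u ^ q / e ^ M\<close> is any \<open>k\<close>-th root of unity, that is, \<open>u ^ (q * k) = e ^ (M * k)\<close>.\<close>
lemma push_to_torus:
  fixes r :: "nat \<Rightarrow> real"
  assumes q: "q > 0" and k: "k > 0" and b: "0 < b" "b < c"
    and r: "\<And>j. j < k \<Longrightarrow> 0 < r j" "\<And>j. j < k \<Longrightarrow> r j < c"
  obtains G where "fibre_isotopy c G"
    "fibre_map (G 1) ` power_fibration ((\<lambda>j. of_real (r j) * cis (2 * pi * real j / real (q * k))) ` {..<k}) q M =
       torus_link_fibration b (M * k) (q * k)"
    "\<And>e. G 1 e 0 = 0"
proof -
  let ?\<zeta> = "\<lambda>j. cis (2 * pi * real j / real k)"
  let ?y = "\<lambda>j. of_real (r j) * cis (2 * pi * real j / real (q * k))"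
  note roots = Complex.bij_betw_roots_unity[OF k]
  define lo hi where "lo = Min (r ` {..<k})" and "hi = Max (r ` {..<k})"
  have ne: "r ` {..<k} \<noteq> {}" "finite (r ` {..<k})"
    using k by auto
  have lohi: "0 < lo" "hi < c" "\<And>j. j < k \<Longrightarrow> lo \<le> r j \<and> r j \<le> hi"
    using r ne by (auto simp: lo_def hi_def)
  define f where "f = (\<lambda>z. r (the_inv_into {..<k} ?\<zeta> z))"
  have f: "f (?\<zeta> j) = r j" if "j < k" for j
    using the_inv_into_f_f[OF bij_betw_imp_inj_on[OF roots], of j] that by (simp add: f_def)
  have "continuous_on (?\<zeta> ` {..<k}) f"
    by (intro continuous_on_finite) simp
  moreover have "closedin (top_of_set UNIV) (?\<zeta> ` {..<k})"
    by (simp add: finite_imp_closed)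
  moreover have "lo \<le> hi"
    using lohi(3)[OF k] by linarith
  moreover have "f z \<in> cbox lo hi" if "z \<in> ?\<zeta> ` {..<k}" for z
    using that f lohi(3) by auto
  ultimately have "\<exists>\<rho>. continuous_on UNIV \<rho> \<and> (\<forall>z \<in> ?\<zeta> ` {..<k}. \<rho> z = f z) \<and> (\<forall>z. \<rho> z \<in> cbox lo hi)"
    by (rule Tietze_closed_interval_1; blast)
  then obtain \<rho> where \<rho>: "continuous_on UNIV \<rho>" "\<And>z. z \<in> ?\<zeta> ` {..<k} \<Longrightarrow> \<rho> z = f z"
      "\<And>z. \<rho> z \<in> cbox lo hi"
    by blast
  have \<rho>_root: "\<rho> (?\<zeta> j) = r j" if "j < k" for j
    using \<rho>(2) f that by simp
  define \<epsilon> where "\<epsilon> = min lo b / 2"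
  have \<epsilon>: "0 < \<epsilon>" "\<epsilon> < lo" "\<epsilon> < b"
    using lohi b by (auto simp: \<epsilon>_def min_def)
  have \<rho>_bounds: "\<epsilon> < \<rho> z" "\<rho> z < c" for z
    using \<rho>(3)[of z] \<epsilon> lohi by auto
  define G where "G = radial_stretch \<epsilon> b c \<rho> q M"
  have iso: "fibre_isotopy c G"
    unfolding G_def using fibre_isotopy_radial_stretch[OF \<epsilon>(1) \<epsilon>(3) b(2) \<rho>(1) \<rho>_bounds] .
  have e_cnj: "e ^ M * cnj e ^ M = 1" if "cmod e = 1" for e
    using that complex_norm_square[of e] by (simp add: power_mult_distrib[symmetric])
  have y_pow: "?y j ^ q = of_real (r j) ^ q * ?\<zeta> j" for j
    using q by (simp add: power_mult_distrib Complex.DeMoivre)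
  have moves: "G 1 e (of_real (r j) * u) = of_real b * u"
    if "j < k" "cmod e = 1" "cmod u = 1" "u ^ q = ?\<zeta> j * e ^ M" for e u j
  proof -
    have "u ^ q * cnj e ^ M = ?\<zeta> j"
      using that(4) e_cnj[OF that(2)] by (simp add: mult.assoc)
    moreover have "\<epsilon> \<le> r j"
      using lohi(3)[OF that(1)] \<epsilon> by linarith
    ultimately show ?thesis
      unfolding G_def radial_stretch_outer[OF \<epsilon>(1) \<open>\<epsilon> \<le> r j\<close> that(3)]
      using \<rho>_root[OF that(1)] \<rho>_bounds[of "?\<zeta> j"] by (simp add: tent_simps)
  qed
  have "fibre_map (G 1) ` power_fibration (?y ` {..<k}) q M = torus_link_fibration b (M * k) (q * k)"
  proof (intro equalityI subsetI)
    fix p assume "p \<in> fibre_map (G 1) ` power_fibration (?y ` {..<k}) q M"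
    then obtain e w where p: "p = (e, G 1 e w)" and ew: "(e, w) \<in> power_fibration (?y ` {..<k}) q M"
      by (auto simp: fibre_map_def)
    then obtain j where e: "cmod e = 1" and j: "j < k" "w ^ q = ?y j ^ q * e ^ M"
      unfolding power_fibration_def by blast
    define u where "u = w / of_real (r j)"
    have "cmod w = r j"
      using power_fibration_modulus[OF q e j(2)] r(1)[OF j(1)] by (simp add: norm_mult)
    then have w: "w = of_real (r j) * u" and u: "cmod u = 1"
      using r(1)[OF j(1)] by (auto simp: u_def norm_divide)
    have uq: "u ^ q = ?\<zeta> j * e ^ M"
      unfolding u_def power_divide j(2) y_pow using r(1)[OF j(1)] by simp
    have "u ^ (q * k) = ?\<zeta> j ^ k * e ^ (M * k)"
      by (simp add: power_mult uq power_mult_distrib)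
    also have "?\<zeta> j ^ k = 1"
      using bij_betwE[OF roots] j(1) by blast
    finally have "(e, of_real b * u) \<in> torus_link_fibration b (M * k) (q * k)"
      using b u e by (simp add: torus_link_fibration_def norm_mult power_mult_distrib)
    then show "p \<in> torus_link_fibration b (M * k) (q * k)"
      unfolding p w moves[OF j(1) e u uq] .
  next
    fix p assume "p \<in> torus_link_fibration b (M * k) (q * k)"
    then obtain e w where p: "p = (e, w)" and e: "cmod e = 1" and w: "cmod w = b"
      and pow: "w ^ (q * k) = of_real b ^ (q * k) * e ^ (M * k)"
      unfolding torus_link_fibration_def by blast
    define u where "u = w / of_real b"
    have wu: "w = of_real b * u" and u: "cmod u = 1"
      using w b by (auto simp: u_def norm_divide)
    have "u ^ (q * k) = e ^ (M * k)"
      using pow b unfolding wu by (simp add: power_mult_distrib)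
    then have "(u ^ q * cnj e ^ M) ^ k = (e ^ M * cnj e ^ M) ^ k"
      by (simp add: power_mult power_mult_distrib)
    then have "(u ^ q * cnj e ^ M) ^ k = 1"
      by (simp add: e_cnj[OF e])
    then obtain j where j: "j < k" "u ^ q * cnj e ^ M = ?\<zeta> j"
      using bij_betw_imp_surj_on[OF roots] by (auto simp: image_iff set_eq_iff)
    have "u ^ q = u ^ q * (e ^ M * cnj e ^ M)"
      by (simp add: e_cnj[OF e])
    also have "\<dots> = ?\<zeta> j * e ^ M"
      unfolding j(2)[symmetric] by (simp add: mult_ac)
    finally have uq: "u ^ q = ?\<zeta> j * e ^ M" .
    have "(of_real (r j) * u) ^ q = ?y j ^ q * e ^ M"
      unfolding y_pow by (simp add: power_mult_distrib uq)
    then have "(e, of_real (r j) * u) \<in> power_fibration (?y ` {..<k}) q M"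
      unfolding power_fibration_def using e j(1) by blast
    moreover have "p = fibre_map (G 1) (e, of_real (r j) * u)"
      unfolding p wu fibre_map_def by (simp add: moves[OF j(1) e u uq])
    ultimately show "p \<in> fibre_map (G 1) ` power_fibration (?y ` {..<k}) q M"
      by blast
  qed
  moreover have "G 1 e 0 = 0" for e
    unfolding G_def using \<rho>_bounds \<epsilon> by (intro radial_stretch_inner) auto
  ultimately show ?thesis using that iso by blast
qed

lemma fibre_map_compose:
  "fibre_map (\<lambda>e w. H e (G e w)) ` A = fibre_map H ` fibre_map G ` A"
  by (auto simp: fibre_map_def image_image case_prod_beta)

lemma spread_over_torus:
  fixes x :: "nat \<Rightarrow> complex"
  assumes q: "q > 0" and k: "k > 0" and b: "0 < b" "b < c"
    and x: "\<And>j. j < k \<Longrightarrow> x j \<noteq> 0" "\<And>j. j < k \<Longrightarrow> cmod (x j) < c"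
    and inj: "inj_on (\<lambda>j. cmod (x j)) {..<k}"
  obtains G where "fibre_isotopy c G"
    "fibre_map (G 1) ` power_fibration (x ` {..<k}) q M = torus_link_fibration b (M * k) (q * k)"
    "\<And>e. G 1 e 0 = 0"
proof -
  let ?P = "power_fibration ((\<lambda>j. of_real (cmod (x j)) * cis (2 * pi * real j / real (q * k))) ` {..<k}) q M"
  have "0 < c" using b by simp
  obtain G where G: "fibre_isotopy c G" "fibre_map (G 1) ` power_fibration (x ` {..<k}) q M = ?P" "\<And>e. G 1 e 0 = 0"
    using fan_out[OF q \<open>0 < c\<close> x inj, of M] by blast
  obtain H where H: "fibre_isotopy c H" "fibre_map (H 1) ` ?P = torus_link_fibration b (M * k) (q * k)" "\<And>e. H 1 e 0 = 0"
    using push_to_torus[OF q k b, of "\<lambda>j. cmod (x j)" M] x by auto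
  show ?thesis
  proof
    show "fibre_isotopy c (\<lambda>t e w. H t e (G t e w))"
      using fibre_isotopy_compose[OF G(1) H(1)] .
    show "fibre_map (\<lambda>e w. H 1 e (G 1 e w)) ` power_fibration (x ` {..<k}) q M = torus_link_fibration b (M * k) (q * k)"
      unfolding fibre_map_compose G(2) H(2) ..
    show "H 1 e (G 1 e 0) = 0" for e
      using G(3) H(3) by simp
  qed
qed

section \<open>The curves of the paradromic ring\<close>
lemma power_fibrationI:
  "cmod e = 1 \<Longrightarrow> z \<in> Z \<Longrightarrow> w ^ q = z ^ q * e ^ M \<Longrightarrow> (e, w) \<in> power_fibration Z q M"
  unfolding power_fibration_def by blast

lemma power_fibration_Un:
  "power_fibration (Z \<union> Z') q M = power_fibration Z q M \<union> power_fibration Z' q M"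
  unfolding power_fibration_def by blast

lemma power_fibration_0: "q > 0 \<Longrightarrow> power_fibration {0} q M = sphere 0 1 \<times> {0}"
  unfolding power_fibration_def by (auto simp: zero_power)

lemma power_fibration_minus: "power_fibration (uminus ` Z) 2 M = power_fibration Z 2 M"
  unfolding power_fibration_def by auto

lemma midline_eq: "n > 0 \<Longrightarrow> midline b n l = b * (2 * real l + 1 - real n) / real n"
  by (simp add: midline_def field_simps)

lemma midline_reflect: "l < n \<Longrightarrow> midline b n (n - 1 - l) = - midline b n l"
  by (simp add: midline_eq of_nat_diff field_simps)

lemma midline_abs_less:
  assumes "0 < b" "l < n"
  shows "\<bar>midline b n l\<bar> < b"
proof -
  have "\<bar>2 * real l + 1 - real n\<bar> < real n"
    using assms(2) by linarith
  then have "b * \<bar>2 * real l + 1 - real n\<bar> < b * real n"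
    using assms(1) by simp
  then show ?thesis
    using assms by (simp add: midline_eq abs_mult pos_divide_less_eq)
qed

lemma midline_inj:
  assumes "b \<noteq> 0" "n > 0"
  shows "inj (midline b n)"
  using assms by (intro injI) (simp add: midline_eq field_simps)

text \<open>Used with \<open>h = k = n / 2\<close>, where the last set is empty, and with \<open>h = (n - 1) / 2\<close>, \<open>k = h + 1\<close>, where it is the
midline at height \<open>0\<close>.\<close>
lemma midlines_symmetric:
  assumes sym: "n = h + k" "h \<le> k" "k \<le> h + 1"
  shows "midline b n ` {..<n} =
    midline b n ` {k..<n} \<union> uminus ` midline b n ` {k..<n} \<union> midline b n ` {h..<k}"
proof (intro equalityI subsetI)
  fix s assume "s \<in> midline b n ` {..<n}"
  then obtain l where l: "l < n" "s = midline b n l" by blast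
  show "s \<in> midline b n ` {k..<n} \<union> uminus ` midline b n ` {k..<n} \<union> midline b n ` {h..<k}"
  proof (cases "l < h")
    case True
    then have "s = - midline b n (n - 1 - l)" "n - 1 - l \<in> {k..<n}"
      using l midline_reflect[of l n b] sym by auto
    then show ?thesis by (metis UnI1 UnI2 image_eqI)
  next
    case False
    then have "l \<in> {k..<n} \<union> {h..<k}"
      using l by auto
    then show ?thesis using l by blast
  qed
next
  fix s assume "s \<in> midline b n ` {k..<n} \<union> uminus ` midline b n ` {k..<n} \<union> midline b n ` {h..<k}"
  moreover have "{k..<n} \<subseteq> {..<n}" "{h..<k} \<subseteq> {..<n}"
    using sym by auto
  ultimately consider l where "l < n" "s = midline b n l" | l where "l < n" "s = - midline b n l"
    by blast
  then show "s \<in> midline b n ` {..<n}"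
  proof cases
    case 2
    then have "s = midline b n (n - 1 - l)" "n - 1 - l < n"
      using midline_reflect[of l n b] by auto
    then show ?thesis by blast
  qed auto
qed

definition band_curves :: "(real \<Rightarrow> real) \<Rightarrow> real set \<Rightarrow> (complex \<times> complex) set" where
  "band_curves \<tau> S = (\<lambda>(\<theta>, s). (cis \<theta>, of_real s * cis (\<tau> \<theta>))) ` ({0..2 * pi} \<times> S)"

lemma paradromic_ring_eq:
  "paradromic_ring a b \<alpha> \<beta> m n =
     torus_point a ` band_curves (twist_angle \<alpha> \<beta> m) (midline b n ` {..<n})"
  unfolding paradromic_ring_def twisted_band_def band_curves_def tube_point_eq
  by (simp add: image_image case_prod_beta)

lemma band_curves_subset:
  assumes "\<And>s. s \<in> S \<Longrightarrow> \<bar>s\<bar> \<le> c"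
  shows "band_curves \<tau> S \<subseteq> sphere 0 1 \<times> cball 0 c"
  using assms by (auto simp: band_curves_def norm_mult)

text \<open>The angle still missing is \<open>0\<close> at both ends of \<open>{0..2 * pi}\<close>, so it is a function on the circle and the disks can be
turned by it; between the radii \<open>b\<close> and \<open>c\<close> the rotation fades out.\<close>
lemma spread_twist_evenly:
  assumes b: "b < c" and S: "\<And>s. s \<in> S \<Longrightarrow> \<bar>s\<bar> \<le> b"
    and \<tau>: "continuous_on {0..2 * pi} \<tau>" "\<tau> 0 = 0" "\<tau> (2 * pi) = real m * pi"
  obtains G where "fibre_isotopy c G"
    "fibre_map (G 1) ` band_curves \<tau> S = band_curves (\<lambda>\<theta>. real m / 2 * \<theta>) S"
proof -
  define g where "g = (\<lambda>\<theta>. real m / 2 * \<theta> - \<tau> \<theta>)"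
  have "continuous_on {0..2 * pi} g" "g (2 * pi) = g 0"
    unfolding g_def using \<tau> by (auto intro!: continuous_intros)
  then obtain D where D: "continuous_on (sphere 0 1) D" "\<And>\<theta>. \<theta> \<in> {0..2 * pi} \<Longrightarrow> D (cis \<theta>) = g \<theta>"
    using periodic_function_on_circle by blast
  define \<kappa> where "\<kappa> = (\<lambda>r. max 0 (min 1 ((c - r) / (c - b))))"
  have \<kappa>: "\<kappa> r = 1" if "r \<le> b" for r
    using that b by (simp add: \<kappa>_def)
  define G where "G = (\<lambda>t e w. w * cis (t * (D e * \<kappa> (cmod w))))"
  have "fibre_isotopy c G"
    unfolding G_def
  proof (rule fibre_isotopy_twist)
    show "continuous_on (sphere 0 1 \<times> UNIV) (\<lambda>p. D (fst p) * \<kappa> (snd p))"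
      unfolding \<kappa>_def using b
      by (auto intro!: continuous_intros continuous_on_compose2[OF D(1)])
    show "D e * \<kappa> r = 0" if "c \<le> r" for e r
    proof -
      have "(c - r) / (c - b) \<le> 0" using that b by (simp add: divide_le_0_iff)
      then show ?thesis by (simp add: \<kappa>_def max_absorb1 min.coboundedI2)
    qed
  qed
  moreover have "fibre_map (G 1) ` band_curves \<tau> S = band_curves (\<lambda>\<theta>. real m / 2 * \<theta>) S"
    unfolding band_curves_def image_image
  proof (intro image_cong refl)
    fix p assume "p \<in> {0..2 * pi} \<times> S"
    then obtain \<theta> s where p: "p = (\<theta>, s)" "\<theta> \<in> {0..2 * pi}" "s \<in> S" by blast
    have "G 1 (cis \<theta>) (of_real s * cis (\<tau> \<theta>)) = of_real s * cis (\<tau> \<theta> + D (cis \<theta>))"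
      using S[OF p(3)] by (simp add: G_def \<kappa> norm_mult mult.assoc cis_mult)
    also have "\<tau> \<theta> + D (cis \<theta>) = real m / 2 * \<theta>"
      unfolding D(2)[OF p(2)] by (simp add: g_def)
    finally show "fibre_map (G 1) (case p of (\<theta>, s) \<Rightarrow> (cis \<theta>, of_real s * cis (\<tau> \<theta>))) =
        (case p of (\<theta>, s) \<Rightarrow> (cis \<theta>, of_real s * cis (real m / 2 * \<theta>)))"
      by (simp add: p fibre_map_def)
  qed
  ultimately show ?thesis using that by blast
qed

lemma twist_angle_properties:
  assumes "0 \<le> \<alpha>" "\<alpha> < \<beta>" "\<beta> \<le> 2 * pi"
  shows "continuous_on A (twist_angle \<alpha> \<beta> m)" "twist_angle \<alpha> \<beta> m 0 = 0"
    "twist_angle \<alpha> \<beta> m (2 * pi) = real m * pi"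
proof -
  show "continuous_on A (twist_angle \<alpha> \<beta> m)"
    unfolding twist_angle_def[abs_def] using assms by (intro continuous_intros) auto
  have "(0 - \<alpha>) / (\<beta> - \<alpha>) \<le> 0" "1 \<le> (2 * pi - \<alpha>) / (\<beta> - \<alpha>)"
    using assms by (simp_all add: divide_le_0_iff)
  then show "twist_angle \<alpha> \<beta> m 0 = 0" "twist_angle \<alpha> \<beta> m (2 * pi) = real m * pi"
    unfolding twist_angle_def by (simp_all add: max_absorb1 min.coboundedI2)
qed

text \<open>The square root of \<open>e ^ m\<close> is determined up to sign, and the sign is absorbed by the symmetry of \<open>S\<close>.\<close>
lemma evenly_twisted_symmetric:
  assumes S: "uminus ` S \<subseteq> S"
  shows "band_curves (\<lambda>\<theta>. real m / 2 * \<theta>) S = power_fibration (of_real ` S) 2 m"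
proof -
  have sq: "cis (real m / 2 * \<theta>) ^ 2 = cis \<theta> ^ m" for \<theta>
    by (simp add: Complex.DeMoivre)
  show ?thesis
  proof (intro equalityI subsetI)
    fix p assume "p \<in> band_curves (\<lambda>\<theta>. real m / 2 * \<theta>) S"
    then obtain \<theta> s where p: "p = (cis \<theta>, of_real s * cis (real m / 2 * \<theta>))" "s \<in> S"
      unfolding band_curves_def by auto
    show "p \<in> power_fibration (of_real ` S) 2 m"
      unfolding p(1)
    proof (rule power_fibrationI)
      show "(of_real s * cis (real m / 2 * \<theta>)) ^ 2 = of_real s ^ 2 * cis \<theta> ^ m"
        unfolding power_mult_distrib sq ..
    qed (use p(2) in auto)
  next
    fix p assume "p \<in> power_fibration (of_real ` S) 2 m"
    then obtain e w s where p: "p = (e, w)" "cmod e = 1" "s \<in> S" "w ^ 2 = of_real s ^ 2 * e ^ m"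
      unfolding power_fibration_def by blast
    obtain \<theta> where \<theta>: "\<theta> \<in> {0..2 * pi}" "e = cis \<theta>"
      using p(2) by (rule unit_complex_cis)
    have "w ^ 2 = (of_real s * cis (real m / 2 * \<theta>)) ^ 2"
      unfolding p(4) \<theta>(2) power_mult_distrib sq ..
    then have "w = of_real s * cis (real m / 2 * \<theta>) \<or> w = of_real (- s) * cis (real m / 2 * \<theta>)"
      unfolding power2_eq_iff by simp
    moreover have "- s \<in> S"
      using p(3) S by auto
    ultimately obtain s' where "s' \<in> S" "w = of_real s' * cis (real m / 2 * \<theta>)"
      using p(3) by metis
    then show "p \<in> band_curves (\<lambda>\<theta>. real m / 2 * \<theta>) S"
      unfolding band_curves_def p(1) \<theta>(2) using \<theta>(1) by (intro image_eqI[of _ _ "(\<theta>, s')"]) auto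
  qed
qed

lemma evenly_twisted_full_turns:
  "band_curves (\<lambda>\<theta>. real (2 * M) / 2 * \<theta>) S = power_fibration (of_real ` S) 1 M"
proof (intro equalityI subsetI)
  fix p assume "p \<in> band_curves (\<lambda>\<theta>. real (2 * M) / 2 * \<theta>) S"
  then show "p \<in> power_fibration (of_real ` S) 1 M"
    by (auto simp: band_curves_def power_fibration_def Complex.DeMoivre)
next
  fix p assume "p \<in> power_fibration (of_real ` S) 1 M"
  then obtain e s where p: "p = (e, of_real s * e ^ M)" "cmod e = 1" "s \<in> S"
    unfolding power_fibration_def by auto
  obtain \<theta> where "\<theta> \<in> {0..2 * pi}" "e = cis \<theta>"
    using p(2) by (rule unit_complex_cis)
  then show "p \<in> band_curves (\<lambda>\<theta>. real (2 * M) / 2 * \<theta>) S"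
    unfolding band_curves_def p(1) using p(3)
    by (intro image_eqI[of _ _ "(\<theta>, s)"]) (auto simp: Complex.DeMoivre)
qed

text \<open>Consecutive midlines have distance \<open>2 * b / n\<close>, so \<open>s + s'\<close> is a multiple of \<open>2 * b / n\<close> for any two of
them. Two shifted points could be opposite, or one of them \<open>0\<close>, only if \<open>s + s'\<close> were minus the
sum of the two shifts. That sum is positive and at most \<open>2 * v = b / n\<close>, which excludes it.
No two of them coincide, because the shift is injective.\<close>
lemma shift_off_core:
  assumes b: "0 < b" "b < c" and n: "n > 0"
  obtains G x where "fibre_isotopy c G"
    "fibre_map (G 1) ` power_fibration (of_real ` midline b n ` {..<n}) 1 M = power_fibration (x ` {..<n}) 1 M"
    "\<And>l. l < n \<Longrightarrow> x l \<noteq> 0" "\<And>l. l < n \<Longrightarrow> cmod (x l) < c" "inj_on (\<lambda>l. cmod (x l)) {..<n}"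
proof -
  \<comment> \<open>a quarter of the distance of consecutive midlines\<close>
  define v where "v = b / (2 * real n)"
  have v: "0 < v" "v < c"
  proof -
    show "0 < v" using b n by (simp add: v_def)
    have "b / (2 * real n) \<le> b / 1"
      using b n by (intro divide_left_mono) auto
    then show "v < c" using b by (simp add: v_def)
  qed
  define G where "G = (\<lambda>t e w. w + of_real (t * v * max 0 (1 - cmod w / c)) * (e::complex) ^ M)"
  have iso: "fibre_isotopy c G"
    unfolding G_def using v by (intro fibre_isotopy_shift) simp
  let ?s = "midline b n"
  define y where "y = (\<lambda>l. ?s l + v * (1 - \<bar>?s l\<bar> / c))"
  have s: "\<bar>?s l\<bar> < c" if "l < n" for l
    using midline_abs_less[OF b(1) that] b by linarith
  have G_s: "G 1 e (of_real (?s l) * e ^ M) = of_real (y l) * e ^ M" if "l < n" "cmod e = 1" for l e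
  proof -
    have "0 \<le> 1 - \<bar>?s l\<bar> / c" using s[OF that(1)] b by simp
    then show ?thesis
      using that(2) by (simp add: G_def y_def norm_mult norm_power max_absorb2 algebra_simps)
  qed
  have G_1: "G 1 1 (of_real (?s l)) = of_real (y l)" if "l < n" for l
    using G_s[OF that, of 1] by simp
  have inj_G: "inj (G 1 1)"
    using iso unfolding fibre_isotopy_def by auto
  have y_inj: "l = l'" if "l < n" "l' < n" "y l = y l'" for l l'
  proof -
    have "G 1 1 (of_real (?s l)) = G 1 1 (of_real (?s l'))"
      using that by (simp add: G_1)
    then have "?s l = ?s l'"
      using inj_G by (simp add: inj_eq)
    then show ?thesis
      using midline_inj[of b n] b n by (simp add: inj_eq)
  qed
  have y_neg: "y l \<noteq> - y l'" if "l < n" "l' < n" for l l'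
  proof
    assume "y l = - y l'"
    then have eq: "?s l + ?s l' = - (v * (1 - \<bar>?s l\<bar> / c) + v * (1 - \<bar>?s l'\<bar> / c))"
      by (simp add: y_def)
    have "0 < v * (1 - \<bar>?s l\<bar> / c)" "v * (1 - \<bar>?s l\<bar> / c) \<le> v"
         "0 < v * (1 - \<bar>?s l'\<bar> / c)" "v * (1 - \<bar>?s l'\<bar> / c) \<le> v"
      using s[OF that(1)] s[OF that(2)] v b by (auto intro!: mult_left_le)
    then have bounds: "- (2 * v) \<le> ?s l + ?s l'" "?s l + ?s l' < 0"
      unfolding eq by linarith+
    define i where "i = int l + int l' + 1 - int n"
    have "?s l + ?s l' = 4 * v * of_int i"
      using n by (simp add: midline_eq v_def i_def field_simps)
    then have "- (2 * v) \<le> 4 * v * of_int i" "4 * v * of_int i < 0"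
      using bounds by simp_all
    then have "2 * v * (- 1) \<le> 2 * v * (2 * real_of_int i)" "real_of_int i < 0"
      using v by (auto simp: mult_less_0_iff)
    then have "- 1 \<le> 2 * real_of_int i" "i \<le> - 1"
      using v by (simp_all only: mult_le_cancel_left_pos)
    moreover from this have "real_of_int i \<le> - 1"
      by linarith
    ultimately show False by linarith
  qed
  define x where "x = (\<lambda>l. complex_of_real (y l))"
  have "fibre_map (G 1) ` power_fibration (of_real ` ?s ` {..<n}) 1 M = power_fibration (x ` {..<n}) 1 M"
  proof -
    have eq: "power_fibration (z ` {..<n}) 1 M = (\<lambda>(e, l). (e, z l * e ^ M)) ` (sphere 0 1 \<times> {..<n})" for z
      unfolding power_fibration_def by auto
    show ?thesis
      unfolding image_image[of _ ?s] eq unfolding image_image x_def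
      by (intro image_cong refl) (auto simp: fibre_map_def G_s)
  qed
  moreover have "x l \<noteq> 0" if "l < n" for l
    using y_neg[OF that that] by (auto simp: x_def)
  moreover have "cmod (x l) < c" if "l < n" for l
    using fibre_isotopy_bounded[OF iso, of 1 1 "of_real (?s l)"] s[OF that] G_1[OF that]
    by (simp add: x_def)
  moreover have "inj_on (\<lambda>l. cmod (x l)) {..<n}"
    using y_inj y_neg by (intro inj_onI) (auto simp: x_def abs_eq_iff)
  ultimately show ?thesis using that iso by blast
qed

section \<open>Paradromic rings are torus links\<close>
locale band_in_torus =
  fixes a b \<alpha> \<beta> :: real and n :: nat
  assumes b: "0 < b" "b < a" and \<alpha>\<beta>: "0 \<le> \<alpha>" "\<alpha> < \<beta>" "\<beta> \<le> 2 * pi" and n: "n > 0"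
begin

text \<open>Any radius strictly between those of the torus and of its core circle would do.\<close>
definition c :: real where "c = (a + b) / 2"

lemma c: "b < c" "c < a" "0 < c"
  using b by (auto simp: c_def)

lemma paradromic_link_equiv:
  assumes G: "fibre_isotopy c G"
    and image: "torus_point a ` fibre_map (G 1) ` band_curves (\<lambda>\<theta>. real m / 2 * \<theta>) (midline b n ` {..<n}) = L"
    and L: "is_link L"
  shows "paradromic_ring a b \<alpha> \<beta> m n \<simeq>\<^sub>L L"
proof -
  let ?S = "midline b n ` {..<n}"
  have S: "\<bar>s\<bar> \<le> b" if "s \<in> ?S" for s
    using midline_abs_less[OF b(1)] that by fastforce
  obtain H where H: "fibre_isotopy c H"
      "fibre_map (H 1) ` band_curves (twist_angle \<alpha> \<beta> m) ?S = band_curves (\<lambda>\<theta>. real m / 2 * \<theta>) ?S"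
    using spread_twist_evenly[OF c(1) S twist_angle_properties[OF \<alpha>\<beta>]] by blast
  define F where "F = (\<lambda>t e w. G t e (H t e w))"
  have "torus_point a ` fibre_map (F 1) ` band_curves (twist_angle \<alpha> \<beta> m) ?S = L"
    unfolding F_def fibre_map_compose H(2) image ..
  moreover have "fibre_isotopy c F"
    unfolding F_def by (rule fibre_isotopy_compose[OF H(1) G])
  moreover have "band_curves (twist_angle \<alpha> \<beta> m) ?S \<subseteq> sphere 0 1 \<times> cball 0 c"
    using S c(1) by (intro band_curves_subset) force
  ultimately show ?thesis
    unfolding paradromic_ring_eq using fibre_isotopy_link_equiv[of c F a] c L by blast
qed

text \<open>After an even number of half twists every midline closes up on its own, so the points of a disk need not be
moved in opposite pairs.\<close>
lemma paradromic_full_turns: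
  "paradromic_ring a b \<alpha> \<beta> (2 * M) n \<simeq>\<^sub>L torus_link a b (M * n) n"
proof -
  let ?P = "power_fibration (of_real ` midline b n ` {..<n}) 1 M"
  obtain G x where G: "fibre_isotopy c G" "fibre_map (G 1) ` ?P = power_fibration (x ` {..<n}) 1 M"
    and x: "\<And>l. l < n \<Longrightarrow> x l \<noteq> 0" "\<And>l. l < n \<Longrightarrow> cmod (x l) < c" "inj_on (\<lambda>l. cmod (x l)) {..<n}"
    using shift_off_core[OF b(1) c(1) n, of M] by metis
  obtain H where H: "fibre_isotopy c H"
    "fibre_map (H 1) ` power_fibration (x ` {..<n}) 1 M = torus_link_fibration b (M * n) (1 * n)"
    by (rule spread_over_torus[OF zero_less_one n b(1) c(1) x, of M]) (assumption | rule that)+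
  have "fibre_map (\<lambda>e w. H 1 e (G 1 e w)) ` ?P = torus_link_fibration b (M * n) n"
    unfolding fibre_map_compose G(2) H(2) mult_1 ..
  then have "torus_point a ` fibre_map (\<lambda>e w. H 1 e (G 1 e w)) `
      band_curves (\<lambda>\<theta>. real (2 * M) / 2 * \<theta>) (midline b n ` {..<n}) = torus_link a b (M * n) n"
    unfolding evenly_twisted_full_turns torus_link_eq_fibration[OF b(1) n] by (rule arg_cong)
  then show ?thesis
    by (rule paradromic_link_equiv[OF fibre_isotopy_compose[OF G(1) H(1)]])
       (rule is_link_torus_link[OF b n])
qed

text \<open>The positive midlines have different moduli, and squaring identifies each with its negative.\<close>
lemma symmetric_pairs_to_torus:
  assumes k: "n = h + k" "h \<le> k" "k \<le> h + 1" "0 < h"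
  obtains G where "fibre_isotopy c G"
    "fibre_map (G 1) ` power_fibration (of_real ` (midline b n ` {k..<n} \<union> uminus ` midline b n ` {k..<n})) 2 m =
       torus_link_fibration b (m * h) (2 * h)"
    "\<And>e. G 1 e 0 = 0"
proof -
  let ?s = "midline b n"
  define x where "x = (\<lambda>j. complex_of_real (?s (k + j)))"
  have s_pos: "0 < ?s (k + j)" for j
    using b n k by (simp add: midline_eq zero_less_mult_iff)
  have x_cmod: "cmod (x j) = ?s (k + j)" for j
    using s_pos[of j] by (simp add: x_def)
  have "{k..<n} = (+) k ` {..<h}"
    using image_add_atLeastLessThan[of k 0 h] k(1) by (simp add: lessThan_atLeast0 add.commute)
  then have x_image: "of_real ` ?s ` {k..<n} = x ` {..<h}"
    by (simp add: x_def image_image)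
  have "(of_real ` uminus ` ?s ` {k..<n} :: complex set) = uminus ` of_real ` ?s ` {k..<n}"
    by (simp add: image_image)
  then have curves: "power_fibration (of_real ` (?s ` {k..<n} \<union> uminus ` ?s ` {k..<n})) 2 m =
      power_fibration (x ` {..<h}) 2 m"
    by (simp only: image_Un power_fibration_Un power_fibration_minus x_image Un_absorb)
  have x_nz: "x j \<noteq> 0" if "j < h" for j
    using s_pos[of j] by (simp add: x_def)
  have x_less: "cmod (x j) < c" if "j < h" for j
    using midline_abs_less[OF b(1), of "k + j" n] that k c(1) s_pos[of j] by (simp add: x_cmod)
  have x_inj: "inj_on (\<lambda>j. cmod (x j)) {..<h}"
    using midline_inj[of b n] b n by (intro inj_onI) (simp add: x_cmod inj_eq)
  show ?thesis
  proof (rule spread_over_torus[OF zero_less_numeral k(4) b(1) c(1) x_nz x_less x_inj])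
    fix G assume "fibre_isotopy c G" "\<And>e. G 1 e 0 = 0"
      "fibre_map (G 1) ` power_fibration (x ` {..<h}) 2 m = torus_link_fibration b (m * h) (2 * h)"
    then show ?thesis
      using that unfolding curves by blast
  qed
qed

lemma evenly_twisted_midlines:
  assumes "n = h + k" "h \<le> k" "k \<le> h + 1"
  shows "band_curves (\<lambda>\<theta>. real m / 2 * \<theta>) (midline b n ` {..<n}) =
    power_fibration (of_real ` (midline b n ` {k..<n} \<union> uminus ` midline b n ` {k..<n})) 2 m \<union>
    power_fibration (of_real ` midline b n ` {h..<k}) 2 m"
proof -
  have "uminus ` midline b n ` {..<n} \<subseteq> midline b n ` {..<n}"
  proof (intro image_subsetI)
    fix s assume "s \<in> midline b n ` {..<n}"
    then obtain l where l: "l < n" "s = midline b n l" by blast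
    have "- s = midline b n (n - 1 - l)" "n - 1 - l \<in> {..<n}"
      using l midline_reflect[OF l(1), of b] by simp_all
    then show "- s \<in> midline b n ` {..<n}" by blast
  qed
  then have "band_curves (\<lambda>\<theta>. real m / 2 * \<theta>) (midline b n ` {..<n}) = power_fibration (of_real ` midline b n ` {..<n}) 2 m"
    by (rule evenly_twisted_symmetric)
  then show ?thesis
    by (simp only: midlines_symmetric[OF assms, of b] image_Un[of of_real] power_fibration_Un)
qed

lemma paradromic_even_strips:
  assumes "n = 2 * k"
  shows "paradromic_ring a b \<alpha> \<beta> m n \<simeq>\<^sub>L torus_link a b (m * k) n"
proof -
  have k: "n = k + k" "k \<le> k" "k \<le> k + 1" "0 < k"
    using assms n by auto
  obtain G where G: "fibre_isotopy c G"
    "fibre_map (G 1) ` power_fibration (of_real ` (midline b n ` {k..<n} \<union> uminus ` midline b n ` {k..<n})) 2 m =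
       torus_link_fibration b (m * k) (2 * k)"
    "\<And>e. G 1 e 0 = 0"
    using symmetric_pairs_to_torus[OF k, of m] by blast
  have "power_fibration (of_real ` midline b n ` {k..<k}) 2 m = {}"
    by (simp add: power_fibration_def)
  then have curves: "band_curves (\<lambda>\<theta>. real m / 2 * \<theta>) (midline b n ` {..<n}) =
    power_fibration (of_real ` (midline b n ` {k..<n} \<union> uminus ` midline b n ` {k..<n})) 2 m"
    unfolding evenly_twisted_midlines[OF k(1-3)] by (simp only: Un_empty_right)
  show ?thesis
  proof (rule paradromic_link_equiv[OF G(1)])
    show "torus_point a ` fibre_map (G 1) ` band_curves (\<lambda>\<theta>. real m / 2 * \<theta>) (midline b n ` {..<n}) =
        torus_link a b (m * k) n"
      unfolding curves G(2) torus_link_eq_fibration[OF b(1) n] assms[symmetric] ..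
  qed (rule is_link_torus_link[OF b n])
qed

lemma paradromic_odd_strips:
  assumes "n = 2 * h + 1" "0 < h"
  shows "paradromic_ring a b \<alpha> \<beta> m n \<simeq>\<^sub>L torus_link a b (m * h) (2 * h) \<union> torus_core a"
proof -
  have k: "n = h + (h + 1)" "h \<le> h + 1" "h + 1 \<le> h + 1" "0 < h"
    using assms by auto
  let ?P = "power_fibration (of_real ` (midline b n ` {h + 1..<n} \<union> uminus ` midline b n ` {h + 1..<n})) 2 m"
  obtain G where G: "fibre_isotopy c G" "fibre_map (G 1) ` ?P = torus_link_fibration b (m * h) (2 * h)"
      "\<And>e. G 1 e 0 = 0"
    using symmetric_pairs_to_torus[OF k, of m] by blast
  have "midline b n h = 0"
    using n assms by (simp add: midline_eq)
  then have "power_fibration (of_real ` midline b n ` {h..<h + 1}) 2 m = sphere 0 1 \<times> {0}"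
    by (simp add: power_fibration_0)
  then have curves: "band_curves (\<lambda>\<theta>. real m / 2 * \<theta>) (midline b n ` {..<n}) = ?P \<union> sphere 0 1 \<times> {0}"
    unfolding evenly_twisted_midlines[OF k(1-3)] by (simp only:)
  have core: "fibre_map (G 1) ` (sphere 0 1 \<times> {0}) = sphere 0 1 \<times> {0}"
    using G(3) by (force simp: fibre_map_def)
  have image: "fibre_map (G 1) ` (?P \<union> sphere 0 1 \<times> {0}) = torus_link_fibration b (m * h) (2 * h) \<union> sphere 0 1 \<times> {0}"
    unfolding image_Un[of "fibre_map (G 1)"] G(2) core ..
  have h2: "0 < 2 * h" using assms by simp
  show ?thesis
  proof (rule paradromic_link_equiv[OF G(1)])
    show "torus_point a ` fibre_map (G 1) ` band_curves (\<lambda>\<theta>. real m / 2 * \<theta>) (midline b n ` {..<n}) =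
        torus_link a b (m * h) (2 * h) \<union> torus_core a"
      unfolding curves image torus_link_eq_fibration[OF b(1) h2] torus_core_eq by (rule image_Un)
    show "is_link (torus_link a b (m * h) (2 * h) \<union> torus_core a)"
      using is_link_torus_link_Un_core[OF b h2] .
  qed
qed

end

lemma paradromic_ring_single_strip:
  "paradromic_ring a b \<alpha> \<beta> m 1 = paradromic_ring a b \<alpha> \<beta> 0 1"
proof -
  have "midline b 1 ` {..<1} = {0}"
    by (auto simp: midline_def)
  then show ?thesis
    unfolding paradromic_ring_def twisted_band_def tube_point_eq
    by (intro image_cong) auto
qed

theorem theorem1:
  fixes m n :: nat and a b \<alpha> \<beta> :: real
  assumes "0 < b" and "b < a"
    and "0 \<le> \<alpha>" and "\<alpha> < \<beta>" and "\<beta> \<le> 2 * pi"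
    and "n > 0"
  shows "(n = 1 \<longrightarrow> paradromic_ring a b \<alpha> \<beta> m 1 \<simeq>\<^sub>L torus_link a b 0 1) \<and>
         (n > 1 \<longrightarrow>
            (if even (m * n)
             then paradromic_ring a b \<alpha> \<beta> m n \<simeq>\<^sub>L torus_link a b (m * n div 2) n
             else paradromic_ring a b \<alpha> \<beta> m n \<simeq>\<^sub>L
                    torus_link a b (m * (n - 1) div 2) (n - 1) \<union> torus_core a))"
proof -
  interpret band_in_torus a b \<alpha> \<beta> n
    using assms by unfold_locales
  have "paradromic_ring a b \<alpha> \<beta> m 1 \<simeq>\<^sub>L torus_link a b 0 1" if "n = 1"
    using paradromic_full_turns[of 0] that paradromic_ring_single_strip[of a b \<alpha> \<beta> m] by simp
  moreover have "paradromic_ring a b \<alpha> \<beta> m n \<simeq>\<^sub>L torus_link a b (m * n div 2) n" if "even (m * n)"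
  proof (cases "even m")
    case True
    then show ?thesis
      using paradromic_full_turns[of "m div 2"] by (auto elim!: evenE)
  next
    case False
    then show ?thesis
      using paradromic_even_strips[of "n div 2" m] that by (auto elim!: evenE)
  qed
  moreover have "paradromic_ring a b \<alpha> \<beta> m n \<simeq>\<^sub>L
      torus_link a b (m * (n - 1) div 2) (n - 1) \<union> torus_core a" if "odd (m * n)" "n > 1"
  proof -
    have "odd n" using that(1) by simp
    then obtain h where h: "n = 2 * h + 1" by (rule oddE)
    have "m * (n - 1) div 2 = m * h" "n - 1 = 2 * h"
      by (simp_all add: h mult.left_commute)
    then show ?thesis
      using paradromic_odd_strips[OF h, of m] that(2) h by simp
  qed
  ultimately show ?thesis by simp
qed

end
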